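(* Let $1\le p<\infty$, $N\in\mathbb N$. Consider $E\subset\mathfrak{LC}_p$ with $L^1_{loc}$-equicontinuous $m$-bounds and let $\Theta=\{\theta^I_j\mid I=[q_1,q_2],\ q_1,q_2\in\mathbb Q,\ j\in\mathbb N\}$ be the suitable set of moduli of continuity $$\theta^I_j(s)=\sup_{t\in I,\,f\in E}\int_t^{t+s}m_f^j(u)\,du,$$ where $m_f^j$ is the optimal $m$-bound of $f$ on $B_j$. (i) If $(f_n)_{n\in\mathbb N}$ in $E$ converges to $f$ in $(\mathfrak{LC}_p,\mathcal T_\Theta)$ and $(x_{0,n})_{n\in\mathbb N}$ in $\mathbb R^N$ converges to $x_0\in\mathbb R^N$, then $x(\cdot,f_n,x_{0,n})\to x(\cdot,f,x_0)$ as $n\to\infty$, uniformly in any $[T_1,T_2]\subset I_{f,x_0}$. (ii) Moreover, if $(F_n)_{n\in\mathbb N}$ in $\Theta\mathfrak C_p(\mathbb R^{N\times N})$ converges to $F$ in $(\Theta\mathfrak C_p(\mathbb R^{N\times N}),\mathcal T_\Theta)$, $(h_n)_{n\in\mathbb N}$ in $\Theta\mathfrak C_p$ converges to $h$ in $(\Theta\mathfrak C_p,\mathcal T_\Theta)$, and $(y_{0,n})_{n\in\mathbb N}$ in $\mathbb R^N$ converges to $y_0\in\mathbb R^N$, then $$y(\cdot,f_n,F_n,h_n,x_{0,n},y_{0,n})\to y(\cdot,f,F,h,x_0,y_0)\quad\text{as } n\to\infty,$$ uniformly in any $[T_1,T_2]\subset I_{f,x_0}$.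
   Context: $B_j$ is the closed ball of radius $j$ centered at $0$ in $\mathbb R^N$. $L^p_{loc}$ is the set of functions $\mathbb R\to\mathbb R$ belonging to $L^p(I)$ for every compact interval $I$. For a space of functions $f:\mathbb R\times\mathbb R^N\to\mathbb R^M$, the symbol $(\mathbb R^M)$ is omitted when $M=N$. Consider for $f:\mathbb R\times\mathbb R^N\to\mathbb R^M$: (C1) $f$ is Borel measurable; (C2) for every compact $K\subset\mathbb R^N$ there is $m^K\in L^p_{loc}$ with $|f(t,x)|\le m^K(t)$ for a.e. $t$ and all $x\in K$. $\mathfrak{LC}_p(\mathbb R^M)$ is the set of $f$ satisfying (C1), (C2) and: for every compact $K\subset\mathbb R^N$ there is $l^K\in L^p_{loc}$ with $|f(t,x)-f(t,y)|\le l^K(t)|x-y|$ for a.e. $t$ and all $x,y\in K$. A suitable set of moduli of continuity is a countable set of non-decreasing continuous functions $\Theta=\{\theta^I_j:[0,\infty)\to[0,\infty)\mid j\in\mathbb N,\ I=[q_1,q_2],\ q_1,q_2\in\mathbb Q\}$ with $\theta^I_j(0)=0$ and $\theta^{I_1}_{j_1}\le\theta^{I_2}_{j_2}$ whenever $I_1\subseteq I_2$, $j_1\le j_2$; $\mathcal K^I_j$ is the set of continuous functions $I\to B_j$ admitting $\theta^I_j$ as modulus of continuity. $\Theta\mathfrak C_p(\mathbb R^M)$ is the set of $f$ satisfying (C1), (C2) and, for each $j$ and each $I$ with rational endpoints: if $x_n\to x$ uniformly with $x_n,x\in\mathcal K^I_j$, then $\int_I|f(t,x_n(t))-f(t,x(t))|^pdt\to0$.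 Functions in the same space differing only on a Lebesgue-null subset of $\mathbb R^{1+N}$ are identified. $\mathcal T_\Theta$ is the topology (on $\Theta\mathfrak C_p(\mathbb R^M)$, and on $\mathfrak{LC}_p(\mathbb R^M)$) generated by the seminorms $\sup_{x(\cdot)\in\mathcal K^I_j}\big[\int_I|f(t,x(t))|^pdt\big]^{1/p}$, $I$ with rational endpoints, $j\in\mathbb N$. The optimal $m$-bound of $f$ on $B_j$ is $m^j_f(t)=\sup_{x\in B_j}|f(t,x)|$. $E\subset\mathfrak{LC}_p$ has $L^1_{loc}$-equicontinuous $m$-bounds if for each $j\in\mathbb N$ and all $r,\varepsilon>0$ there is $\delta>0$ such that $\sup_{f\in E}\int_s^t m^j_f(u)\,du<\varepsilon$ whenever $-r\le s\le t\le r$, $t-s<\delta$. Under this assumption the family $\Theta$ of the claim is a suitable set of moduli of continuity. For $f\in\mathfrak{LC}_p$, $x_0\in\mathbb R^N$, $x(\cdot,f,x_0)$ is the unique (Carathéodory, i.e. integral) solution of $\dot x=f(t,x)$, $x(0)=x_0$, and $I_{f,x_0}$ is its maximal interval of definition (an open interval). For $F\in\Theta\mathfrak C_p(\mathbb R^{N\times N})$, $h\in\Theta\mathfrak C_p$, $y_0\in\mathbb R^N$, $y(\cdot,f,F,h,x_0,y_0)$ is the solution on $I_{f,x_0}$ of $\dot y=F(t,x(t,f,x_0))\,y+h(t,x(t,f,x_0))$, $y(0)=y_0$. The uniform convergence statements include that, for $n$ large, the solutions for $f_n$ are defined on $[T_1,T_2]$. *)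

theory Defs
  imports "HOL-Analysis.Analysis"
begin

text \<open>
  A function \<open>f : \<real> \<times> \<real>\<^sup>N \<rightarrow> \<real>\<^sup>M\<close> is curried, \<open>f :: real \<Rightarrow> 'a \<Rightarrow> 'b\<close>. The spaces below consist
  of representatives: functions that agree outside a null set of \<open>\<real>\<^sup>1\<^sup>+\<^sup>N\<close> have the same seminorms,
  hence are topologically indistinguishable, and convergence does not depend on the representative.
\<close>

section \<open>Spaces of Caratheodory functions\<close>

definition Lp_loc :: "real \<Rightarrow> (real \<Rightarrow> real) set" where
  "Lp_loc p = {m. m \<in> borel_measurable lebesgue \<and>
     (\<forall>a b. set_integrable lebesgue {a..b} (\<lambda>t. \<bar>m t\<bar> powr p))}"

definition C1 :: "(real \<Rightarrow> 'a::euclidean_space \<Rightarrow> 'b::euclidean_space) \<Rightarrow> bool" where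
  "C1 f \<longleftrightarrow> (\<lambda>(t, x). f t x) \<in> borel_measurable borel"

definition C2 :: "real \<Rightarrow> (real \<Rightarrow> 'a::euclidean_space \<Rightarrow> 'b::euclidean_space) \<Rightarrow> bool" where
  "C2 p f \<longleftrightarrow> (\<forall>K. compact K \<longrightarrow>
     (\<exists>m \<in> Lp_loc p. AE t in lebesgue. \<forall>x\<in>K. norm (f t x) \<le> m t))"

definition LC :: "real \<Rightarrow> (real \<Rightarrow> 'a::euclidean_space \<Rightarrow> 'b::euclidean_space) set" where
  "LC p = {f. C1 f \<and> C2 p f \<and>
     (\<forall>K. compact K \<longrightarrow>
       (\<exists>l \<in> Lp_loc p. AE t in lebesgue.
          \<forall>x\<in>K. \<forall>y\<in>K. norm (f t x - f t y) \<le> l t * norm (x - y)))}"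

text \<open>A family \<open>\<theta>\<^sup>I\<^sub>j\<close> with \<open>I = [q\<^sub>1,q\<^sub>2]\<close> is a function of \<open>q\<^sub>1, q\<^sub>2, j\<close>; only its values at rational
  \<open>q\<^sub>1 \<le> q\<^sub>2\<close> and at arguments \<open>s \<ge> 0\<close> are relevant.\<close>

type_synonym moduli = "real \<Rightarrow> real \<Rightarrow> nat \<Rightarrow> real \<Rightarrow> real"

definition suitable_moduli :: "moduli \<Rightarrow> bool" where
  "suitable_moduli \<Theta> \<longleftrightarrow>
     (\<forall>q1\<in>\<rat>. \<forall>q2\<in>\<rat>. \<forall>j. q1 \<le> q2 \<longrightarrow>
        \<Theta> q1 q2 j 0 = 0 \<and> (\<forall>s\<ge>0. \<Theta> q1 q2 j s \<ge> 0) \<and>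
        mono_on {0..} (\<Theta> q1 q2 j) \<and> continuous_on {0..} (\<Theta> q1 q2 j)) \<and>
     (\<forall>q1\<in>\<rat>. \<forall>q2\<in>\<rat>. \<forall>r1\<in>\<rat>. \<forall>r2\<in>\<rat>. \<forall>i j.
        q1 \<le> q2 \<longrightarrow> {q1..q2} \<subseteq> {r1..r2} \<longrightarrow> i \<le> j \<longrightarrow>
        (\<forall>s\<ge>0. \<Theta> q1 q2 i s \<le> \<Theta> r1 r2 j s))"

text \<open>\<open>\<K>\<^sup>I\<^sub>j\<close>; its members are total functions, constrained (and later used) only on \<open>I\<close>.\<close>

definition moduli_set :: "moduli \<Rightarrow> real \<Rightarrow> real \<Rightarrow> nat \<Rightarrow> (real \<Rightarrow> 'a::euclidean_space) set" where
  "moduli_set \<Theta> q1 q2 j = {x. continuous_on {q1..q2} x \<and> x ` {q1..q2} \<subseteq> cball 0 (real j) \<and>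
     (\<forall>s\<in>{q1..q2}. \<forall>t\<in>{q1..q2}. norm (x s - x t) \<le> \<Theta> q1 q2 j \<bar>s - t\<bar>)}"

definition ThetaC :: "moduli \<Rightarrow> real \<Rightarrow> (real \<Rightarrow> 'a::euclidean_space \<Rightarrow> 'b::euclidean_space) set" where
  "ThetaC \<Theta> p = {f. C1 f \<and> C2 p f \<and>
     (\<forall>q1\<in>\<rat>. \<forall>q2\<in>\<rat>. \<forall>j. q1 \<le> q2 \<longrightarrow>
       (\<forall>xs x. (\<forall>n. xs n \<in> moduli_set \<Theta> q1 q2 j) \<longrightarrow> x \<in> moduli_set \<Theta> q1 q2 j \<longrightarrow>
          uniform_limit {q1..q2} xs x sequentially \<longrightarrow>
          (\<lambda>n. LINT t:{q1..q2}|lborel. norm (f t (xs n t) - f t (x t)) powr p) \<longlonglongrightarrow> 0))}"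

definition Theta_seminorm ::
    "moduli \<Rightarrow> real \<Rightarrow> real \<Rightarrow> real \<Rightarrow> nat \<Rightarrow>
     (real \<Rightarrow> 'a::euclidean_space \<Rightarrow> 'b::euclidean_space) \<Rightarrow> real" where
  "Theta_seminorm \<Theta> p q1 q2 j f =
     (SUP x \<in> moduli_set \<Theta> q1 q2 j. (LINT t:{q1..q2}|lborel. norm (f t (x t)) powr p) powr (1 / p))"

text \<open>The topology \<open>\<T>\<^sub>\<Theta>\<close> on a space \<open>X\<close> of functions, in which the seminorm balls form a subbase.\<close>

definition T_Theta ::
    "moduli \<Rightarrow> real \<Rightarrow> (real \<Rightarrow> 'a::euclidean_space \<Rightarrow> 'b::euclidean_space) set \<Rightarrow>
     (real \<Rightarrow> 'a \<Rightarrow> 'b) topology" where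
  "T_Theta \<Theta> p X = topology_generated_by
     {{g \<in> X. Theta_seminorm \<Theta> p q1 q2 j (\<lambda>t x. g t x - f t x) < e} | f q1 q2 j e.
        f \<in> X \<and> q1 \<in> \<rat> \<and> q2 \<in> \<rat> \<and> q1 \<le> q2 \<and> 0 < e}"

section \<open>m-bounds\<close>

text \<open>The optimal m-bound is extended-real valued: it may be infinite for \<open>t\<close> in a null set.
  For \<open>f \<in> LC p\<close> it is in general only Lebesgue measurable, hence integrals with respect to
  \<open>lebesgue\<close>.\<close>

definition opt_m_bound ::
    "(real \<Rightarrow> 'a::euclidean_space \<Rightarrow> 'b::euclidean_space) \<Rightarrow> nat \<Rightarrow> real \<Rightarrow> ennreal" where
  "opt_m_bound f j t = (SUP x \<in> cball 0 (real j). ennreal (norm (f t x)))"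

definition L1loc_equicontinuous_m_bounds ::
    "(real \<Rightarrow> 'a::euclidean_space \<Rightarrow> 'b::euclidean_space) set \<Rightarrow> bool" where
  "L1loc_equicontinuous_m_bounds E \<longleftrightarrow>
     (\<forall>j. \<forall>r>0. \<forall>\<epsilon>>0. \<exists>\<delta>>0. \<forall>s t. - r \<le> s \<and> s \<le> t \<and> t \<le> r \<and> t - s < \<delta> \<longrightarrow>
        (SUP f\<in>E. \<integral>\<^sup>+u\<in>{s..t}. opt_m_bound f j u \<partial>lebesgue) < ennreal \<epsilon>)"

text \<open>The supremum is finite if \<open>E\<close> has \<open>L\<^sup>1\<^sub>l\<^sub>o\<^sub>c\<close>-equicontinuous m-bounds, so that \<^const>\<open>enn2real\<close>
  loses nothing; see \<open>moduli_of_finite\<close> below.\<close>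

definition moduli_of ::
    "(real \<Rightarrow> 'a::euclidean_space \<Rightarrow> 'b::euclidean_space) set \<Rightarrow> moduli" where
  "moduli_of E q1 q2 j s =
     enn2real (SUP t\<in>{q1..q2}. SUP f\<in>E. \<integral>\<^sup>+u\<in>{t..t + s}. opt_m_bound f j u \<partial>lebesgue)"

section \<open>Solutions\<close>

text \<open>\<open>x\<close> solves \<open>x' = g(t,x)\<close>, \<open>x(0) = x\<^sub>0\<close> in the sense of Caratheodory on the open interval \<open>I\<close>.\<close>

definition caratheodory_solution ::
    "(real \<Rightarrow> 'a::euclidean_space \<Rightarrow> 'a) \<Rightarrow> 'a \<Rightarrow> real set \<Rightarrow> (real \<Rightarrow> 'a) \<Rightarrow> bool" where
  "caratheodory_solution g x0 I x \<longleftrightarrow>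
     open I \<and> is_interval I \<and> 0 \<in> I \<and> continuous_on I x \<and>
     (\<forall>t\<in>I. interval_lebesgue_integrable lborel 0 (ereal t) (\<lambda>s. g s (x s)) \<and>
            x t = x0 + interval_lebesgue_integral lborel 0 (ereal t) (\<lambda>s. g s (x s)))"

definition maximal_solution ::
    "(real \<Rightarrow> 'a::euclidean_space \<Rightarrow> 'a) \<Rightarrow> 'a \<Rightarrow> real set \<Rightarrow> (real \<Rightarrow> 'a) \<Rightarrow> bool" where
  "maximal_solution g x0 I x \<longleftrightarrow> caratheodory_solution g x0 I x \<and>
     (\<forall>J z. caratheodory_solution g x0 J z \<and> I \<subseteq> J \<and> (\<forall>t\<in>I. z t = x t) \<longrightarrow> J = I)"

text \<open>\<open>I\<^bsub>f,x\<^sub>0\<^esub>\<close>, \<open>x(\<cdot>,f,x\<^sub>0)\<close> and \<open>y(\<cdot>,f,F,h,x\<^sub>0,y\<^sub>0)\<close>. For \<open>f \<in> LC p\<close> and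
  \<open>F, h \<in> ThetaC \<Theta> p\<close> they exist and are unique; the values of the solutions outside the
  interval are irrelevant.\<close>

definition sol_interval :: "(real \<Rightarrow> 'a::euclidean_space \<Rightarrow> 'a) \<Rightarrow> 'a \<Rightarrow> real set" where
  "sol_interval f x0 = (THE I. \<exists>x. maximal_solution f x0 I x)"

definition sol :: "(real \<Rightarrow> 'a::euclidean_space \<Rightarrow> 'a) \<Rightarrow> 'a \<Rightarrow> real \<Rightarrow> 'a" where
  "sol f x0 = (SOME x. caratheodory_solution f x0 (sol_interval f x0) x)"

definition lin_sol ::
    "(real \<Rightarrow> real^'n \<Rightarrow> real^'n) \<Rightarrow> (real \<Rightarrow> real^'n \<Rightarrow> real^'n^'n) \<Rightarrow>
     (real \<Rightarrow> real^'n \<Rightarrow> real^'n) \<Rightarrow> real^'n \<Rightarrow> real^'n \<Rightarrow> real \<Rightarrow> real^'n" where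
  "lin_sol f F h x0 y0 =
     (SOME y. caratheodory_solution (\<lambda>t v. F t (sol f x0 t) *v v + h t (sol f x0 t)) y0
        (sol_interval f x0) y)"

section \<open>Well-definedness of the moduli\<close>

lemma opt_m_bound_measurable:
  assumes "f \<in> LC p"
  shows "opt_m_bound f j \<in> borel_measurable lebesgue"
proof -
  let ?B = "cball (0::'a) (real j)"
  have C1: "(\<lambda>(t, x). f t x) \<in> borel_measurable borel"
    using assms by (simp add: LC_def C1_def)
  from assms obtain l where
    l: "AE t in lebesgue. \<forall>x\<in>?B. \<forall>y\<in>?B. norm (f t x - f t y) \<le> l t * norm (x - y)"
    unfolding LC_def using compact_cball by blast
  obtain D where D: "countable D" "D \<subseteq> ?B" "?B \<subseteq> closure D"
    using separable[of ?B] by blast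
  have meas: "(\<lambda>t. SUP x\<in>D. ennreal (norm (f t x))) \<in> borel_measurable borel"
  proof (rule borel_measurable_SUP[OF D(1)])
    fix x assume "x \<in> D"
    have "(\<lambda>t. (\<lambda>(t, x). f t x) (t, x)) \<in> borel_measurable borel"
      by (rule measurable_compose[OF _ C1]) (intro borel_measurable_continuous_onI continuous_intros)
    then show "(\<lambda>t. ennreal (norm (f t x))) \<in> borel_measurable borel" by simp
  qed
  have eq: "AE t in lebesgue. opt_m_bound f j t = (SUP x\<in>D. ennreal (norm (f t x)))"
    using l
  proof eventually_elim
    case (elim t)
    have le: "ennreal (norm (f t x)) \<le> (SUP x\<in>D. ennreal (norm (f t x)))" if x: "x \<in> ?B" for x
    proof -
      from x D obtain X where X: "\<And>n. X n \<in> D" "X \<longlonglongrightarrow> x"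
        by (meson closure_sequential subsetD)
      have "(\<lambda>n. norm (X n - x)) \<longlonglongrightarrow> 0" using X(2) by (simp add: LIM_zero tendsto_norm_zero)
      then have "(\<lambda>n. l t * norm (X n - x)) \<longlonglongrightarrow> 0" using tendsto_mult_right_zero by blast
      then have "(\<lambda>n. f t (X n) - f t x) \<longlonglongrightarrow> 0"
        by (rule Lim_null_comparison[rotated])
          (intro always_eventually allI elim[rule_format] x subsetD[OF D(2) X(1)])
      then have "(\<lambda>n. ennreal (norm (f t (X n)))) \<longlonglongrightarrow> ennreal (norm (f t x))"
        by (intro tendsto_ennrealI tendsto_norm) (rule LIM_zero_cancel)
      then show ?thesis
        by (rule LIMSEQ_le_const2) (use X in \<open>auto intro!: exI[of _ 0] SUP_upper\<close>)
    qed
    show ?case unfolding opt_m_bound_def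
      by (intro antisym SUP_least le SUP_subset_mono D(2) order_refl)
  qed
  show ?thesis
  proof (rule measurableI)
    fix A :: "ennreal set" assume A: "A \<in> sets borel"
    let ?g = "\<lambda>t. SUP x\<in>D. ennreal (norm (f t x))"
    have "?g -` A \<in> sets borel" using measurable_sets[OF meas A] by simp
    then have g: "?g -` A \<in> sets lebesgue" by auto
    have "AE t in lebesgue. (t \<in> ?g -` A) = (t \<in> opt_m_bound f j -` A)"
      using eq by eventually_elim auto
    then have "opt_m_bound f j -` A \<in> sets lebesgue"
      by (rule completion.in_sets_AE[OF _ g]) auto
    then show "opt_m_bound f j -` A \<inter> space lebesgue \<in> sets lebesgue" by simp
  qed simp
qed

lemma m_bound_SUP_split:
  assumes "E \<subseteq> LC p" "0 \<le> s" "s \<le> s'"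
    and small: "\<And>t. t \<in> {q1..q2} \<Longrightarrow>
      (SUP f\<in>E. \<integral>\<^sup>+u\<in>{t + s..t + s'}. opt_m_bound f j u \<partial>lebesgue) \<le> e"
  shows "(SUP t\<in>{q1..q2}. SUP f\<in>E. \<integral>\<^sup>+u\<in>{t..t + s'}. opt_m_bound f j u \<partial>lebesgue) \<le>
         (SUP t\<in>{q1..q2}. SUP f\<in>E. \<integral>\<^sup>+u\<in>{t..t + s}. opt_m_bound f j u \<partial>lebesgue) + e"
proof (intro SUP_least)
  fix t f assume t: "t \<in> {q1..q2}" and f: "f \<in> E"
  have m: "opt_m_bound f j \<in> borel_measurable lebesgue"
    using opt_m_bound_measurable assms(1) f by blast
  have i: "(\<lambda>u. opt_m_bound f j u * indicator {a..b} u) \<in> borel_measurable lebesgue" for a b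
    by (intro borel_measurable_times_ennreal m borel_measurable_indicator) auto
  have "(\<integral>\<^sup>+u\<in>{t..t + s'}. opt_m_bound f j u \<partial>lebesgue) \<le>
        (\<integral>\<^sup>+u. opt_m_bound f j u * indicator {t..t + s} u +
              opt_m_bound f j u * indicator {t + s..t + s'} u \<partial>lebesgue)"
    by (intro nn_integral_mono) (auto simp: indicator_def)
  also have "\<dots> = (\<integral>\<^sup>+u\<in>{t..t + s}. opt_m_bound f j u \<partial>lebesgue) +
       (\<integral>\<^sup>+u\<in>{t + s..t + s'}. opt_m_bound f j u \<partial>lebesgue)"
    by (rule nn_integral_add[OF i i])
  also have "\<dots> \<le> (SUP t\<in>{q1..q2}. SUP f\<in>E. \<integral>\<^sup>+u\<in>{t..t + s}. opt_m_bound f j u \<partial>lebesgue) + e"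
  proof (rule add_mono)
    show "(\<integral>\<^sup>+u\<in>{t..t + s}. opt_m_bound f j u \<partial>lebesgue) \<le>
      (SUP t\<in>{q1..q2}. SUP f\<in>E. \<integral>\<^sup>+u\<in>{t..t + s}. opt_m_bound f j u \<partial>lebesgue)"
      by (rule SUP_upper2[OF t], rule SUP_upper2[OF f]) simp
    show "(\<integral>\<^sup>+u\<in>{t + s..t + s'}. opt_m_bound f j u \<partial>lebesgue) \<le> e"
      by (rule order_trans[OF _ small[OF t]], rule SUP_upper2[OF f]) simp
  qed
  finally show "(\<integral>\<^sup>+u\<in>{t..t + s'}. opt_m_bound f j u \<partial>lebesgue) \<le> \<dots>" .
qed

lemma m_bound_SUP_uniform:
  assumes E: "E \<subseteq> LC p" "L1loc_equicontinuous_m_bounds E" and "0 < e"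
  obtains d where "0 < d" "\<And>s s'. 0 \<le> s \<Longrightarrow> s \<le> s' \<Longrightarrow> s' \<le> R \<Longrightarrow> s' - s < d \<Longrightarrow>
      (SUP t\<in>{q1..q2}. SUP f\<in>E. \<integral>\<^sup>+u\<in>{t..t + s'}. opt_m_bound f j u \<partial>lebesgue) \<le>
      (SUP t\<in>{q1..q2}. SUP f\<in>E. \<integral>\<^sup>+u\<in>{t..t + s}. opt_m_bound f j u \<partial>lebesgue) + ennreal e"
proof -
  define r where "r = \<bar>q1\<bar> + \<bar>q2\<bar> + \<bar>R\<bar> + 1"
  have "r > 0" by (simp add: r_def)
  with E(2) \<open>0 < e\<close> obtain d where d: "d > 0" "\<And>s t. - r \<le> s \<and> s \<le> t \<and> t \<le> r \<and> t - s < d \<Longrightarrow>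
        (SUP f\<in>E. \<integral>\<^sup>+u\<in>{s..t}. opt_m_bound f j u \<partial>lebesgue) < ennreal e"
    unfolding L1loc_equicontinuous_m_bounds_def by blast
  show thesis
  proof (rule that[OF d(1)])
    fix s s' :: real assume *: "0 \<le> s" "s \<le> s'" "s' \<le> R" "s' - s < d"
    show "(SUP t\<in>{q1..q2}. SUP f\<in>E. \<integral>\<^sup>+u\<in>{t..t + s'}. opt_m_bound f j u \<partial>lebesgue) \<le>
      (SUP t\<in>{q1..q2}. SUP f\<in>E. \<integral>\<^sup>+u\<in>{t..t + s}. opt_m_bound f j u \<partial>lebesgue) + ennreal e"
    proof (rule m_bound_SUP_split[OF E(1) *(1,2)])
      fix t assume t: "t \<in> {q1..q2}"
      show "(SUP f\<in>E. \<integral>\<^sup>+u\<in>{t + s..t + s'}. opt_m_bound f j u \<partial>lebesgue) \<le> ennreal e"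
        by (rule less_imp_le, rule d(2)) (use t * in \<open>auto simp: r_def\<close>)
    qed
  qed
qed

lemma m_bound_SUP_zero:
  "(SUP t\<in>{q1..q2}. SUP f\<in>E. \<integral>\<^sup>+u\<in>{t..t + 0}. opt_m_bound f j u \<partial>lebesgue) = 0"
proof -
  have "(\<integral>\<^sup>+u\<in>{t}. opt_m_bound f j u \<partial>lebesgue) = 0" for f :: "real \<Rightarrow> 'a \<Rightarrow> 'b" and t
    by (rule nn_integral_null_set) (simp add: null_sets_completionI)
  then show ?thesis by (auto simp flip: bot_ennreal)
qed

lemma moduli_of_finite:
  assumes E: "E \<subseteq> LC p" "L1loc_equicontinuous_m_bounds E" and "0 \<le> s"
  shows "(SUP t\<in>{q1..q2}. SUP f\<in>E. \<integral>\<^sup>+u\<in>{t..t + s}. opt_m_bound f j u \<partial>lebesgue) < top"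
    (is "?V s < top")
proof -
  obtain d where d: "0 < d" "\<And>a b. 0 \<le> a \<Longrightarrow> a \<le> b \<Longrightarrow> b \<le> s \<Longrightarrow> b - a < d \<Longrightarrow>
      ?V b \<le> ?V a + ennreal 1"
    by (rule m_bound_SUP_uniform[OF E zero_less_one, of s j q1 q2]) (rule that)
  have *: "0 \<le> a \<Longrightarrow> a \<le> s \<Longrightarrow> a \<le> real n * (d / 2) \<Longrightarrow> ?V a < top" for a n
  proof (induction n arbitrary: a)
    case 0
    then have "a = 0" by simp
    then show ?case using m_bound_SUP_zero[of j E q1 q2] by simp
  next
    case (Suc n)
    let ?b = "max 0 (a - d / 2)"
    have "?V ?b < top"
      using Suc.prems d(1) by (intro Suc.IH max.boundedI) (auto simp: algebra_simps)
    then have "?V ?b + ennreal 1 < top"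
      by (simp only: ennreal_add_less_top ennreal_less_top simp_thms)
    moreover have "?V a \<le> ?V ?b + ennreal 1"
      by (rule d(2)) (use Suc.prems d(1) in auto)
    ultimately show ?case
      by (rule order_le_less_trans[rotated])
  qed
  obtain n where "s / (d / 2) \<le> real n"
    using real_arch_simple by blast
  then have "s \<le> real n * (d / 2)"
    using d(1) by (simp add: field_simps)
  then show ?thesis by (rule *[OF \<open>0 \<le> s\<close> order_refl])
qed

lemma suitable_moduli_moduli_of:
  assumes E: "E \<subseteq> LC p" "L1loc_equicontinuous_m_bounds E"
  shows "suitable_moduli (moduli_of E)"
proof -
  note fin = moduli_of_finite[OF E]
  have mono: "moduli_of E q1 q2 i s \<le> moduli_of E r1 r2 j s'"
    if "{q1..q2} \<subseteq> {r1..r2}" "i \<le> j" "0 \<le> s" "s \<le> s'" for q1 q2 r1 r2 i j s s'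
    unfolding moduli_of_def
  proof (rule enn2real_mono)
    have le: "opt_m_bound f i u \<le> opt_m_bound f j u" for f :: "real \<Rightarrow> 'a \<Rightarrow> 'b" and u
      unfolding opt_m_bound_def by (intro SUP_subset_mono) (use that in auto)
    have ind: "indicator {t..t + s} u \<le> (indicator {t..t + s'} u :: ennreal)" for t u
      using that by (simp add: indicator_def)
    show "(SUP t\<in>{q1..q2}. SUP f\<in>E. \<integral>\<^sup>+u\<in>{t..t + s}. opt_m_bound f i u \<partial>lebesgue)
      \<le> (SUP t\<in>{r1..r2}. SUP f\<in>E. \<integral>\<^sup>+u\<in>{t..t + s'}. opt_m_bound f j u \<partial>lebesgue)"
      by (intro SUP_subset_mono nn_integral_mono mult_mono order_refl le ind that(1)) simp_all
    show "(SUP t\<in>{r1..r2}. SUP f\<in>E. \<integral>\<^sup>+u\<in>{t..t + s'}. opt_m_bound f j u \<partial>lebesgue) < top"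
      by (rule fin) (use that in linarith)
  qed
  have cont: "continuous_on {0..} (moduli_of E q1 q2 j)" for q1 q2 j
    unfolding continuous_on_iff
  proof (intro ballI allI impI)
    fix s e :: real assume s: "s \<in> {0..}" and e: "0 < e"
    let ?V = "\<lambda>s. SUP t\<in>{q1..q2}. SUP f\<in>E. \<integral>\<^sup>+u\<in>{t..t + s}. opt_m_bound f j u \<partial>lebesgue"
    obtain d where d: "0 < d" "\<And>a b. 0 \<le> a \<Longrightarrow> a \<le> b \<Longrightarrow> b \<le> s + 1 \<Longrightarrow> b - a < d \<Longrightarrow>
      ?V b \<le> ?V a + ennreal (e / 2)"
      by (rule m_bound_SUP_uniform[OF E half_gt_zero[OF e], of "s + 1" j q1 q2]) (rule that)
    have step: "\<bar>moduli_of E q1 q2 j b - moduli_of E q1 q2 j a\<bar> < e"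
      if ab: "0 \<le> a" "a \<le> b" "b \<le> s + 1" "b - a < d" for a b
    proof -
      have "enn2real (?V b) \<le> enn2real (?V a + ennreal (e / 2))"
        by (rule enn2real_mono[OF d(2)[OF ab]])
          (simp only: ennreal_add_less_top ennreal_less_top fin[OF ab(1)] simp_thms)
      also have "\<dots> = enn2real (?V a) + e / 2"
        using e by (subst enn2real_plus[OF fin[OF ab(1)] ennreal_less_top]) simp
      finally have "moduli_of E q1 q2 j b \<le> moduli_of E q1 q2 j a + e / 2"
        by (simp add: moduli_of_def)
      moreover have "moduli_of E q1 q2 j a \<le> moduli_of E q1 q2 j b"
        using mono[of q1 q2 q1 q2 j j a b] ab by simp
      ultimately show ?thesis using e by simp
    qed
    show "\<exists>d>0. \<forall>s'\<in>{0..}. dist s' s < d \<longrightarrow>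
      dist (moduli_of E q1 q2 j s') (moduli_of E q1 q2 j s) < e"
    proof (intro exI[of _ "min d 1"] conjI ballI impI)
      fix s' assume s': "s' \<in> {0..}" "dist s' s < min d 1"
      show "dist (moduli_of E q1 q2 j s') (moduli_of E q1 q2 j s) < e"
      proof (cases "s \<le> s'")
        case True
        have "\<bar>moduli_of E q1 q2 j s' - moduli_of E q1 q2 j s\<bar> < e"
          by (rule step) (use True s s' in \<open>simp_all add: dist_real_def\<close>)
        then show ?thesis by (simp only: dist_real_def)
      next
        case False
        have "\<bar>moduli_of E q1 q2 j s - moduli_of E q1 q2 j s'\<bar> < e"
          by (rule step) (use False s s' in \<open>simp_all add: dist_real_def\<close>)
        then show ?thesis by (simp only: dist_real_def abs_minus_commute)
      qed
    qed (use d in auto)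
  qed
  have zero: "moduli_of E q1 q2 j 0 = 0" for q1 q2 j
    using m_bound_SUP_zero[of j E q1 q2] by (simp add: moduli_of_def)
  have nonneg: "0 \<le> moduli_of E q1 q2 j s" for q1 q2 j s
    by (simp add: moduli_of_def)
  show ?thesis
    unfolding suitable_moduli_def
  proof (intro conjI ballI allI impI cont zero nonneg)
    show "mono_on {0..} (moduli_of E q1 q2 j)" for q1 q2 j
      by (rule mono_onI) (rule mono; simp)
  qed (rule mono; simp)
qed

lemma topspace_T_Theta [simp]: "topspace (T_Theta \<Theta> p X) = X"
proof
  show "topspace (T_Theta \<Theta> p X) \<subseteq> X"
    unfolding T_Theta_def topology_generated_by_topspace by auto
  show "X \<subseteq> topspace (T_Theta \<Theta> p X)"
  proof
    fix f :: "real \<Rightarrow> 'a \<Rightarrow> 'b" assume f: "f \<in> X"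
    define e where "e = max 1 (Theta_seminorm \<Theta> p 0 0 0 (\<lambda>t x. f t x - f t x) + 1)"
    let ?A = "{g \<in> X. Theta_seminorm \<Theta> p 0 0 0 (\<lambda>t x. g t x - f t x) < e}"
    have "0 < e" by (simp add: e_def)
    then have "openin (T_Theta \<Theta> p X) ?A"
      unfolding T_Theta_def using f
      by (intro topology_generated_by_Basis CollectI exI[of _ f] exI[of _ 0] exI[of _ e]) simp
    moreover have "f \<in> ?A" using f by (simp add: e_def)
    ultimately show "f \<in> topspace (T_Theta \<Theta> p X)"
      using openin_subset by blast
  qed
qed
end

theory Submission
  imports Defs
begin

text \<open>
  Both parts compare an approximating solution with the limit solution by Gronwall's inequality. What
  has to be small is the integral of \<open>|f\<^sub>n - f|\<close> along the approximating solution. The topology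
  \<open>\<T>\<^sub>\<Theta>\<close> provides this, since its seminorms are suprema over all curves in a ball with modulus of
  continuity \<open>\<theta>\<^sup>I\<^sub>j\<close>, and \<open>\<theta>\<^sup>I\<^sub>j\<close> is built from the m-bounds of \<open>E\<close> so that solutions of
  \<open>x' = f\<^sub>n(t, x)\<close> are such curves while they stay in the ball.

  A solution of the \<open>n\<close>-th equation need not stay in the ball, or even exist on the interval, and this
  is resolved by truncation rather than by stopping times: \<open>f\<^sub>n\<close> is composed with the projection onto the
  ball, so that the solution \<open>z\<^sub>n\<close> exists globally, and as the projection is 1-Lipschitz the projected
  curve belongs to \<open>\<K>\<^sup>I\<^sub>j\<close> for every \<open>n\<close>. Gronwall's inequality, with the Lipschitz bound of \<open>f\<close> as
  kernel, makes \<open>z\<^sub>n\<close> converge to the limit solution; hence eventually \<open>z\<^sub>n\<close> does not see the truncation,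
  solves the original equation, and by uniqueness is the maximal solution
  (\<open>solutions_converge_on\<close>, \<open>sol_converge_on\<close>).

  In the linear equation the coefficients along the \<open>n\<close>-th solution converge in \<open>L\<^sup>1\<close>, by the seminorms
  and by the continuity of \<open>F\<close> and \<open>h\<close> along curves with a common modulus of continuity. Another use
  of Gronwall's inequality concludes (\<open>linear_solutions_converge_on\<close>).

  The theory of Caratheodory equations that this requires is developed from one estimate,
  \<open>exponential_weight\<close>: an integrable kernel on a compact interval is a contraction in a norm with an
  exponential weight. From it follow Gronwall's inequality, global existence for globally Lipschitz
  right-hand sides, uniqueness, and the existence of maximal solutions.
\<close>

section \<open>Integrals from the initial time\<close>

lemma interval_integrable_iff_segment:
  fixes h :: "real \<Rightarrow> 'a::euclidean_space"
  shows "interval_lebesgue_integrable lborel 0 (ereal t) h \<longleftrightarrow>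
    set_integrable lborel (closed_segment 0 t) h"
proof -
  have *: "set_integrable lborel {c<..<d} h \<longleftrightarrow> set_integrable lborel {c..d} h" for c d
    unfolding set_integrable_def
    by (rule integrable_discrete_difference[where X="{c, d}"]) (auto simp: indicator_def)
  show ?thesis
    by (auto simp: interval_lebesgue_integrable_def zero_ereal_def einterval_eq *
        closed_segment_eq_real_ivl)
qed

lemma set_integrable_segment:
  fixes h :: "real \<Rightarrow> 'a::euclidean_space"
  assumes "set_integrable lborel {a..b} h" "a \<le> 0" "0 \<le> b" "t \<in> {a..b}"
  shows "set_integrable lborel (closed_segment 0 t) h"
proof (rule set_integrable_subset[OF assms(1)])
  show "closed_segment 0 t \<in> sets lborel" by (simp add: closed_segment_eq_real_ivl)
  show "closed_segment 0 t \<subseteq> {a..b}" using assms by (auto simp: closed_segment_eq_real_ivl)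
qed

lemma LBINT_diff:
  fixes h :: "real \<Rightarrow> 'a::euclidean_space"
  assumes h: "set_integrable lborel {a..b} h" and "a \<le> 0" "0 \<le> b" "s \<in> {a..b}" "t \<in> {a..b}" "s \<le> t"
  shows "(LBINT u=0..ereal t. h u) - (LBINT u=0..ereal s. h u) = (LINT u:{s..t}|lborel. h u)"
proof -
  have "(LBINT u=ereal 0..ereal s. h u) + (LBINT u=ereal s..ereal t. h u) = (LBINT u=ereal 0..ereal t. h u)"
  proof (rule interval_integral_sum)
    have "set_integrable lborel {min 0 (min s t)<..<max 0 (max s t)} h"
      by (rule set_integrable_subset[OF h]) (use assms in auto)
    then show "interval_lebesgue_integrable lborel (min (ereal 0) (min (ereal s) (ereal t)))
        (max (ereal 0) (max (ereal s) (ereal t))) h"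
      by (simp add: interval_lebesgue_integrable_def le_max_iff_disj min_le_iff_disj
          flip: ereal_min ereal_max)
  qed
  moreover have "(LBINT u=ereal s..ereal t. h u) = (LINT u:{s..t}|lborel. h u)"
    using \<open>s \<le> t\<close> by (rule interval_integral_Icc)
  ultimately show ?thesis by (simp add: zero_ereal_def algebra_simps)
qed

lemma norm_LBINT_le:
  fixes h :: "real \<Rightarrow> 'a::euclidean_space"
  assumes "set_integrable lborel (closed_segment 0 t) h"
  shows "norm (LBINT s=0..ereal t. h s) \<le> (LINT s:closed_segment 0 t|lborel. norm (h s))"
proof -
  have *: "norm (LBINT s=ereal 0..ereal t. h s) = norm (LINT s:closed_segment 0 t|lborel. h s)"
  proof (cases "0 \<le> t")
    case True
    then show ?thesis by (simp add: interval_integral_Icc closed_segment_eq_real_ivl)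
  next
    case False
    then show ?thesis
      by (subst interval_integral_endpoints_reverse)
        (simp add: interval_integral_Icc closed_segment_eq_real_ivl)
  qed
  show ?thesis unfolding zero_ereal_def *
    by (rule set_integral_norm_bound[OF assms])
qed

lemma LBINT_0_diff:
  fixes g h :: "real \<Rightarrow> 'a::euclidean_space"
  assumes "set_integrable lborel (closed_segment 0 t) g" "set_integrable lborel (closed_segment 0 t) h"
  shows "(LBINT s=0..ereal t. g s) - (LBINT s=0..ereal t. h s) = (LBINT s=0..ereal t. g s - h s)"
  using assms by (intro interval_lebesgue_integral_diff(2)[symmetric])
    (simp_all add: interval_integrable_iff_segment)

lemma set_integral_mono_subset:
  fixes h :: "real \<Rightarrow> real"
  assumes h: "set_integrable lborel B h" and "A \<subseteq> B" "A \<in> sets lborel" "\<And>s. s \<in> B \<Longrightarrow> 0 \<le> h s"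
  shows "(LINT s:A|lborel. h s) \<le> (LINT s:B|lborel. h s)"
proof -
  have "set_integrable lborel A h" using assms set_integrable_subset by blast
  then show ?thesis
    unfolding set_lebesgue_integral_def set_integrable_def
    by (rule integral_mono[OF _ h[unfolded set_integrable_def]])
      (use assms in \<open>auto simp: indicator_def\<close>)
qed

lemma bounded_on_Icc:
  fixes x :: "real \<Rightarrow> 'a::real_normed_vector"
  assumes "continuous_on {a..b} x"
  obtains R where "\<And>s. s \<in> {a..b} \<Longrightarrow> norm (x s) \<le> R"
  using compact_imp_bounded[OF compact_continuous_image[OF assms compact_Icc]]
  unfolding bounded_iff by blast

lemma set_integrable_mult_continuous:
  fixes l u :: "real \<Rightarrow> real"
  assumes l: "set_integrable lborel {a..b} l" and u: "continuous_on {a..b} u"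
  shows "set_integrable lborel {a..b} (\<lambda>s. l s * u s)"
proof -
  obtain M where M: "\<And>s. s \<in> {a..b} \<Longrightarrow> norm (u s) \<le> M"
    using bounded_on_Icc[OF u] by blast
  have "set_borel_measurable lborel {a..b} u"
    using borel_measurable_continuous_on_indicator[OF _ u] by (simp add: set_borel_measurable_def)
  then have "(\<lambda>s. (indicator {a..b} s *\<^sub>R l s) * (indicator {a..b} s *\<^sub>R u s)) \<in> borel_measurable lborel"
    using l unfolding set_borel_measurable_def set_integrable_def
    by (intro borel_measurable_times) (auto dest: borel_measurable_integrable)
  then have "set_borel_measurable lborel {a..b} (\<lambda>s. l s * u s)"
    unfolding set_borel_measurable_def
    by (rule measurable_cong[THEN iffD1, rotated]) (auto simp: indicator_def)
  moreover have "set_integrable lborel {a..b} (\<lambda>s. l s * M)" using l by simp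
  moreover have "norm (l s * u s) \<le> norm (l s * M)" if "s \<in> {a..b}" for s
    using M[OF that] by (auto simp: abs_mult intro!: mult_left_mono)
  ultimately show ?thesis
    using set_integrable_bound[of lborel "{a..b}" "\<lambda>s. l s * M" "\<lambda>s. l s * u s"] by blast
qed

lemma continuous_on_LBINT:
  fixes h :: "real \<Rightarrow> 'a::euclidean_space"
  assumes h: "set_integrable lborel {a..b} h" and ab: "a \<le> 0" "0 \<le> b"
  shows "continuous_on {a..b} (\<lambda>t. LBINT s=0..ereal t. h s)"
proof -
  have "continuous_on {a..b} (\<lambda>t. integral {a..t} h)"
    by (rule indefinite_integral_continuous_1[OF set_borel_integral_eq_integral(1)[OF h]])
  then have "continuous_on {a..b} (\<lambda>t. integral {a..t} h + (LBINT s=0..ereal a. h s))"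
    by (intro continuous_intros)
  then show ?thesis
  proof (rule continuous_on_cong[THEN iffD1, rotated 2, OF _ refl])
    fix t assume t: "t \<in> {a..b}"
    have "set_integrable lborel {a..t} h"
      by (rule set_integrable_subset[OF h]) (use t in auto)
    then show "integral {a..t} h + (LBINT s=0..ereal a. h s) = (LBINT s=0..ereal t. h s)"
      using LBINT_diff[OF h ab, of a t] t ab set_borel_integral_eq_integral(2)[of "{a..t}" h]
      by (simp add: algebra_simps)
  qed
qed

section \<open>An exponential weight for an integrable Lipschitz bound\<close>

text \<open>
  An unbounded \<open>l\<close> splits as \<open>min l K\<close> plus a remainder that has small integral once \<open>K\<close> is
  large. Against the increasing function \<open>e\<^bsup>\<kappa>|s|\<^esup>\<close> the remainder contributes at most its integral
  times the endpoint value, and the bounded part contributes at most \<open>K/\<kappa>\<close> times that value. So the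
  weight absorbs an integrable Lipschitz bound without any differentiation of \<open>\<integral>l\<close>, which would
  need Lebesgue's theorem.
\<close>

lemma exponential_weight:
  fixes l :: "real \<Rightarrow> real"
  assumes l: "set_integrable lborel {a..b} l" and l0: "\<And>s. 0 \<le> l s" and ab: "a \<le> 0" "0 \<le> b"
  obtains \<kappa> where "0 < \<kappa>"
    "\<And>t. t \<in> {a..b} \<Longrightarrow>
      (LINT s:closed_segment 0 t|lborel. l s * exp (\<kappa> * \<bar>s\<bar>)) \<le> exp (\<kappa> * \<bar>t\<bar>) / 2"
proof -
  define r where "r K s = l s - min (l s) K" for K s
  have l': "integrable lborel (\<lambda>s. indicator {a..b} s *\<^sub>R l s)" using l by (simp add: set_integrable_def)
  have r_int: "set_integrable lborel {a..b} (r K)" if "0 \<le> K" for K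
  proof -
    have "(\<lambda>s. indicator {a..b} s *\<^sub>R l s - min (indicator {a..b} s *\<^sub>R l s) K) \<in> borel_measurable lborel"
      using borel_measurable_integrable[OF l'] by measurable
    then have "set_borel_measurable lborel {a..b} (r K)"
      unfolding set_borel_measurable_def r_def
      by (rule measurable_cong[THEN iffD1, rotated]) (auto simp: indicator_def that)
    then show ?thesis
      by (rule set_integrable_bound[OF l]) (use l0 that in \<open>auto simp: r_def\<close>)
  qed
  have "(\<lambda>n. LINT s|lborel. indicator {a..b} s *\<^sub>R r (real n) s) \<longlonglongrightarrow> integral\<^sup>L lborel (\<lambda>s::real. 0::real)"
  proof (rule integral_dominated_convergence[where w="\<lambda>s. indicator {a..b} s *\<^sub>R l s"])
    show "AE s in lborel. (\<lambda>n. indicator {a..b} s *\<^sub>R r (real n) s) \<longlonglongrightarrow> 0"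
    proof (intro AE_I2 tendsto_eventually)
      fix s
      obtain n0 where "l s \<le> real n0" using real_arch_simple by blast
      then have "indicator {a..b} s *\<^sub>R r (real n) s = 0" if "n \<ge> n0" for n
        using that by (auto simp: r_def)
      then show "\<forall>\<^sub>F n in sequentially. indicator {a..b} s *\<^sub>R r (real n) s = 0"
        by (rule eventually_sequentiallyI)
    qed
    show "AE s in lborel. norm (indicator {a..b} s *\<^sub>R r (real n) s) \<le> indicator {a..b} s *\<^sub>R l s" for n
      using l0 by (auto simp: indicator_def r_def)
    show "(\<lambda>s. indicator {a..b} s *\<^sub>R r (real n) s) \<in> borel_measurable lborel" for n
      using r_int[of "real n"] by (auto simp: set_integrable_def)
  qed (use l' in auto)
  then have "(\<lambda>n. LINT s:{a..b}|lborel. r (real n) s) \<longlonglongrightarrow> 0"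
    by (simp add: set_lebesgue_integral_def)
  then have "\<forall>\<^sub>F n in sequentially. (LINT s:{a..b}|lborel. r (real n) s) < 1/4"
    by (rule order_tendstoD) simp
  with eventually_gt_at_top[of 0] have "\<forall>\<^sub>F n in sequentially. 0 < n \<and> (LINT s:{a..b}|lborel. r (real n) s) < 1/4"
    by eventually_elim simp
  then obtain n where n: "0 < n" "(LINT s:{a..b}|lborel. r (real n) s) < 1/4"
    using eventually_happens'[OF sequentially_bot] by blast
  define K where "K = real n"
  have K: "0 < K" "(LINT s:{a..b}|lborel. r K s) < 1/4" using n by (auto simp: K_def)
  \<comment> \<open>Each of the two parts of \<open>l\<close> then contributes a quarter of the endpoint value.\<close>
  define \<kappa> where "\<kappa> = 4 * K"
  have lam: "0 < \<kappa>" using K by (simp add: \<kappa>_def)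
  show thesis
  proof (rule that[OF lam])
    fix t assume t: "t \<in> {a..b}"
    let ?S = "closed_segment 0 t"
    have S: "?S \<subseteq> {a..b}" "?S \<in> sets lborel" using t ab by (auto simp: closed_segment_eq_real_ivl)
    have rS: "set_integrable lborel ?S (r K)"
      by (rule set_integrable_segment[OF r_int ab t]) (use K in simp)
    have le: "\<bar>s\<bar> \<le> \<bar>t\<bar>" if "s \<in> ?S" for s using that by (auto simp: closed_segment_eq_real_ivl split: if_splits)
    have c: "continuous_on A (\<lambda>s. exp (\<kappa> * \<bar>s\<bar>))" for A by (intro continuous_intros)
    have expint: "set_integrable lborel ?S (\<lambda>s. exp (\<kappa> * \<bar>s\<bar>))"
      by (simp add: closed_segment_eq_real_ivl borel_integrable_atLeastAtMost' c)
    have "(LINT s:?S|lborel. l s * exp (\<kappa> * \<bar>s\<bar>)) \<le>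
        (LINT s:?S|lborel. r K s * exp (\<kappa> * \<bar>t\<bar>) + K * exp (\<kappa> * \<bar>s\<bar>))"
    proof (rule set_integral_mono)
      show "set_integrable lborel ?S (\<lambda>s. l s * exp (\<kappa> * \<bar>s\<bar>))"
        by (rule set_integrable_subset[OF set_integrable_mult_continuous[OF l c] S(2,1)])
      show "set_integrable lborel ?S (\<lambda>s. r K s * exp (\<kappa> * \<bar>t\<bar>) + K * exp (\<kappa> * \<bar>s\<bar>))"
        using rS expint by (intro set_integral_add) auto
      fix s assume s: "s \<in> ?S"
      have "l s * exp (\<kappa> * \<bar>s\<bar>) = r K s * exp (\<kappa> * \<bar>s\<bar>) + min (l s) K * exp (\<kappa> * \<bar>s\<bar>)"
        by (simp add: r_def algebra_simps)
      also have "\<dots> \<le> r K s * exp (\<kappa> * \<bar>t\<bar>) + K * exp (\<kappa> * \<bar>s\<bar>)"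
        using le[OF s] lam K by (intro add_mono mult_mono) (auto simp: r_def)
      finally show "l s * exp (\<kappa> * \<bar>s\<bar>) \<le> r K s * exp (\<kappa> * \<bar>t\<bar>) + K * exp (\<kappa> * \<bar>s\<bar>)" .
    qed
    also have "\<dots> = (LINT s:?S|lborel. r K s) * exp (\<kappa> * \<bar>t\<bar>) + K * (LINT s:?S|lborel. exp (\<kappa> * \<bar>s\<bar>))"
      using rS expint by (subst set_integral_add) auto
    also have "\<dots> \<le> (1/4) * exp (\<kappa> * \<bar>t\<bar>) + K * (exp (\<kappa> * \<bar>t\<bar>) / \<kappa>)"
    proof (intro add_mono mult_right_mono mult_left_mono)
      have "(LINT s:?S|lborel. r K s) \<le> (LINT s:{a..b}|lborel. r K s)"
        by (rule set_integral_mono_subset[OF r_int]) (use S K in \<open>auto simp: r_def\<close>)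
      then show "(LINT s:?S|lborel. r K s) \<le> 1/4" using K by simp
      show "(LINT s:?S|lborel. exp (\<kappa> * \<bar>s\<bar>)) \<le> exp (\<kappa> * \<bar>t\<bar>) / \<kappa>"
      proof (cases "0 \<le> t")
        case True
        have "(LINT s:?S|lborel. exp (\<kappa> * \<bar>s\<bar>)) = (\<integral>s. exp (\<kappa> * s) * indicator {0..t} s \<partial>lborel)"
          unfolding set_lebesgue_integral_def using True
          by (intro Bochner_Integration.integral_cong) (auto simp: indicator_def closed_segment_eq_real_ivl)
        also have "\<dots> = exp (\<kappa> * t) / \<kappa> - exp (\<kappa> * 0) / \<kappa>"
          using lam True by (intro integral_FTC_Icc_real) (auto intro!: derivative_eq_intros continuous_intros)
        finally show ?thesis using lam True by simp
      next
        case False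
        have "(LINT s:?S|lborel. exp (\<kappa> * \<bar>s\<bar>)) = (\<integral>s. exp (- \<kappa> * s) * indicator {t..0} s \<partial>lborel)"
          unfolding set_lebesgue_integral_def using False
          by (intro Bochner_Integration.integral_cong) (auto simp: indicator_def closed_segment_eq_real_ivl)
        also have "\<dots> = - exp (- \<kappa> * 0) / \<kappa> - (- exp (- \<kappa> * t) / \<kappa>)"
          using lam False by (intro integral_FTC_Icc_real) (auto intro!: derivative_eq_intros continuous_intros)
        finally show ?thesis using lam False by simp
      qed
    qed (use K in auto)
    also have "\<dots> = exp (\<kappa> * \<bar>t\<bar>) / 2" using K by (simp add: \<kappa>_def)
    finally show "(LINT s:?S|lborel. l s * exp (\<kappa> * \<bar>s\<bar>)) \<le> exp (\<kappa> * \<bar>t\<bar>) / 2" .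
  qed
qed

section \<open>Gronwall's inequality and Picard iteration\<close>

text \<open>
  In the norm weighted by \<open>e\<^bsup>\<kappa>|t|\<^esup>\<close> the Volterra operator with kernel \<open>l\<close> has norm at most one half.
  Both Gronwall's inequality and the convergence of the Picard iterates rest on this contraction.
\<close>

lemma weighted_integral_bound:
  fixes u l :: "real \<Rightarrow> real"
  assumes l: "set_integrable lborel {a..b} l" "\<And>s. 0 \<le> l s" and ab: "a \<le> 0" "0 \<le> b"
    and w: "\<And>t. t \<in> {a..b} \<Longrightarrow>
      (LINT s:closed_segment 0 t|lborel. l s * exp (\<kappa> * \<bar>s\<bar>)) \<le> exp (\<kappa> * \<bar>t\<bar>) / 2"
    and u: "continuous_on {a..b} u" "\<And>s. s \<in> {a..b} \<Longrightarrow> u s \<le> M * exp (\<kappa> * \<bar>s\<bar>)"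
    and M: "0 \<le> M" and t: "t \<in> {a..b}"
  shows "(LINT s:closed_segment 0 t|lborel. l s * u s) \<le> M / 2 * exp (\<kappa> * \<bar>t\<bar>)"
proof -
  have c: "continuous_on {a..b} (\<lambda>s. exp (\<kappa> * \<bar>s\<bar>))" by (intro continuous_intros)
  have S: "closed_segment 0 t \<subseteq> {a..b}" using t ab by (auto simp: closed_segment_eq_real_ivl)
  note int = set_integrable_segment[OF set_integrable_mult_continuous[OF l(1)] ab t]
  have "(LINT s:closed_segment 0 t|lborel. l s * u s) \<le>
    (LINT s:closed_segment 0 t|lborel. M * (l s * exp (\<kappa> * \<bar>s\<bar>)))"
  proof (rule set_integral_mono[OF int[OF u(1)]])
    show "set_integrable lborel (closed_segment 0 t) (\<lambda>s. M * (l s * exp (\<kappa> * \<bar>s\<bar>)))"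
      using int[OF c] by simp
    fix s assume "s \<in> closed_segment 0 t"
    then have "l s * u s \<le> l s * (M * exp (\<kappa> * \<bar>s\<bar>))"
      using S u(2) l(2) by (intro mult_left_mono) auto
    then show "l s * u s \<le> M * (l s * exp (\<kappa> * \<bar>s\<bar>))" by (simp add: mult_ac)
  qed
  also have "\<dots> = M * (LINT s:closed_segment 0 t|lborel. l s * exp (\<kappa> * \<bar>s\<bar>))" by simp
  also have "\<dots> \<le> M * (exp (\<kappa> * \<bar>t\<bar>) / 2)" by (rule mult_left_mono[OF w[OF t] M])
  finally show ?thesis by simp
qed

text \<open>
  The constant depends on the kernel only. It must not depend on \<open>u\<close> and \<open>c\<close>, because below \<open>u\<close> is
  the distance of the \<open>n\<close>-th solution from the limit solution, with \<open>c\<close> tending to \<open>0\<close>.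
\<close>

lemma gronwall:
  fixes l :: "real \<Rightarrow> real"
  assumes l: "set_integrable lborel {a..b} l" "\<And>s. 0 \<le> l s" and ab: "a \<le> 0" "0 \<le> b"
  shows "\<exists>C>0. \<forall>c u. continuous_on {a..b} u \<and>
      (\<forall>s\<in>{a..b}. 0 \<le> u s \<and> u s \<le> c + (LINT r:closed_segment 0 s|lborel. l r * u r)) \<longrightarrow>
      (\<forall>t\<in>{a..b}. u t \<le> C * c)"
proof -
  obtain \<kappa> where k: "0 < \<kappa>" and w: "\<And>t. t \<in> {a..b} \<Longrightarrow>
      (LINT s:closed_segment 0 t|lborel. l s * exp (\<kappa> * \<bar>s\<bar>)) \<le> exp (\<kappa> * \<bar>t\<bar>) / 2"
    using exponential_weight[OF l ab] by metis
  define C where "C = 2 * exp (\<kappa> * (b - a))"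
  show ?thesis
  proof (intro exI[of _ C] conjI allI impI ballI)
    fix c t and u :: "real \<Rightarrow> real"
    assume "continuous_on {a..b} u \<and>
      (\<forall>s\<in>{a..b}. 0 \<le> u s \<and> u s \<le> c + (LINT r:closed_segment 0 s|lborel. l r * u r))"
    then have u: "continuous_on {a..b} u" "\<And>s. s \<in> {a..b} \<Longrightarrow> 0 \<le> u s"
      "\<And>s. s \<in> {a..b} \<Longrightarrow> u s \<le> c + (LINT r:closed_segment 0 s|lborel. l r * u r)"
      by auto
    assume t: "t \<in> {a..b}"
    have wt: "1 \<le> exp (\<kappa> * \<bar>s\<bar>)" for s using k by simp
    have "AE r in lborel. indicator (closed_segment 0 0) r *\<^sub>R (l r * u r) = 0"
      using AE_lborel_singleton[of 0] by eventually_elim auto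
    then have "(LINT r:closed_segment 0 0|lborel. l r * u r) = 0"
      unfolding set_lebesgue_integral_def by (rule integral_eq_zero_AE)
    then have "0 \<le> u 0" "u 0 \<le> c"
      using u(2)[of 0] u(3)[of 0] ab by auto
    then have c: "0 \<le> c" by simp
    obtain M where M: "\<And>s. s \<in> {a..b} \<Longrightarrow> norm (u s) \<le> M"
      using bounded_on_Icc[OF u(1)] by blast
    have "0 \<le> M" using M[of 0] ab by auto
    \<comment> \<open>Each use of the integral inequality halves the excess over \<open>2c\<close> of the weighted supremum.\<close>
    have it: "u s \<le> (2 * c + M / 2 ^ n) * exp (\<kappa> * \<bar>s\<bar>)" if "s \<in> {a..b}" for s n
      using that
    proof (induction n arbitrary: s)
      case 0
      have "u s \<le> (2 * c + M) * 1" using M[OF 0] c by simp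
      also have "\<dots> \<le> (2 * c + M) * exp (\<kappa> * \<bar>s\<bar>)"
        using wt c \<open>0 \<le> M\<close> by (intro mult_left_mono) auto
      finally show ?case by simp
    next
      case (Suc n)
      have "u s \<le> c * 1 + (2 * c + M / 2 ^ n) / 2 * exp (\<kappa> * \<bar>s\<bar>)"
      proof -
        have "(LINT r:closed_segment 0 s|lborel. l r * u r) \<le> (2 * c + M / 2 ^ n) / 2 * exp (\<kappa> * \<bar>s\<bar>)"
          by (rule weighted_integral_bound[OF l ab w u(1) Suc.IH _ Suc.prems])
            (use c \<open>0 \<le> M\<close> in auto)
        with u(3)[OF Suc.prems] show ?thesis by linarith
      qed
      also have "\<dots> \<le> c * exp (\<kappa> * \<bar>s\<bar>) + (2 * c + M / 2 ^ n) / 2 * exp (\<kappa> * \<bar>s\<bar>)"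
        using wt c by (intro add_right_mono mult_left_mono) auto
      also have "\<dots> = (2 * c + M / 2 ^ Suc n) * exp (\<kappa> * \<bar>s\<bar>)" by (simp add: field_simps)
      finally show ?case .
    qed
    have "(\<lambda>n. (2 * c + M * (1/2) ^ n) * exp (\<kappa> * \<bar>t\<bar>)) \<longlonglongrightarrow> (2 * c + M * 0) * exp (\<kappa> * \<bar>t\<bar>)"
      by (intro tendsto_intros LIMSEQ_power_zero) simp
    then have "u t \<le> (2 * c + M * 0) * exp (\<kappa> * \<bar>t\<bar>)"
      by (rule LIMSEQ_le_const) (use it[OF t] in \<open>simp add: power_divide\<close>)
    also have "\<dots> = 2 * c * exp (\<kappa> * \<bar>t\<bar>)" by simp
    also have "\<dots> \<le> 2 * c * exp (\<kappa> * (b - a))"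
      using t ab k c by (intro mult_left_mono) (auto intro!: mult_left_mono simp: abs_if)
    finally show "u t \<le> C * c" by (simp add: C_def mult_ac)
  qed (simp add: C_def)
qed

text \<open>
  Solutions on a compact interval around the initial time, on which all estimates take place;
  \<^const>\<open>caratheodory_solution\<close> is its counterpart for open intervals.
\<close>

definition solves_on :: "(real \<Rightarrow> 'a::euclidean_space \<Rightarrow> 'a) \<Rightarrow> 'a \<Rightarrow> real \<Rightarrow> real \<Rightarrow> (real \<Rightarrow> 'a) \<Rightarrow> bool" where
  "solves_on g x0 a b x \<longleftrightarrow> continuous_on {a..b} x \<and>
     set_integrable lborel {a..b} (\<lambda>s. g s (x s)) \<and>
     (\<forall>t\<in>{a..b}. x t = x0 + (LBINT s=0..ereal t. g s (x s)))"

text \<open>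
  The Lipschitz condition is global in space, so the iterates live on the whole of \<open>[a, b]\<close> and no
  solution has to be continued. Successive differences halve in the weighted norm.
\<close>

theorem picard:
  fixes g :: "real \<Rightarrow> 'a::euclidean_space \<Rightarrow> 'a"
  assumes ab: "a \<le> 0" "0 \<le> b"
    and meas: "\<And>x. continuous_on {a..b} x \<Longrightarrow> set_borel_measurable lborel {a..b} (\<lambda>t. g t (x t))"
    and l: "set_integrable lborel {a..b} l" "\<And>t. 0 \<le> l t"
    and lip: "AE t in lborel. t \<in> {a..b} \<longrightarrow> (\<forall>x y. norm (g t x - g t y) \<le> l t * norm (x - y))"
    and m: "set_integrable lborel {a..b} m"
    and bound: "AE t in lborel. t \<in> {a..b} \<longrightarrow> norm (g t 0) \<le> m t"
  obtains x where "solves_on g x0 a b x"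
proof -
  have int: "set_integrable lborel {a..b} (\<lambda>t. g t (x t))" if x: "continuous_on {a..b} x" for x
  proof (rule set_integrable_bound[OF _ meas[OF x]])
    have "continuous_on {a..b} (\<lambda>t. norm (x t))" using x by (intro continuous_intros)
    then show "set_integrable lborel {a..b} (\<lambda>t. m t + l t * norm (x t))"
      by (intro set_integral_add m set_integrable_mult_continuous l)
    show "AE t in lborel. t \<in> {a..b} \<longrightarrow> norm (g t (x t)) \<le> norm (m t + l t * norm (x t))"
      using lip bound
    proof eventually_elim
      case (elim t)
      show ?case
      proof
        assume t: "t \<in> {a..b}"
        have "norm (g t (x t) - g t 0) \<le> l t * norm (x t - 0)" using elim t by blast
        then show "norm (g t (x t)) \<le> norm (m t + l t * norm (x t))"
          using elim t norm_triangle_ineq2[of "g t (x t)" "g t 0"] by auto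
      qed
    qed
  qed
  define T where "T x = (\<lambda>t. x0 + (LBINT s=0..ereal t. g s (x s)))" for x
  have T_cont: "continuous_on {a..b} (T x)" if "continuous_on {a..b} x" for x
    unfolding T_def by (intro continuous_intros continuous_on_LBINT int that ab)
  have T_diff: "norm (T x t - T y t) \<le> (LINT s:closed_segment 0 t|lborel. l s * norm (x s - y s))"
    if x: "continuous_on {a..b} x" and y: "continuous_on {a..b} y" and t: "t \<in> {a..b}" for x y t
  proof -
    note ii = set_integrable_segment[OF _ ab t]
    have c: "continuous_on {a..b} (\<lambda>s. norm (x s - y s))" using x y by (intro continuous_intros)
    have d: "set_integrable lborel (closed_segment 0 t) (\<lambda>s. g s (x s) - g s (y s))"
      by (intro ii set_integral_diff int x y)
    have "T x t - T y t = (LBINT s=0..ereal t. g s (x s) - g s (y s))"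
      unfolding T_def by (subst LBINT_0_diff[symmetric]) (auto intro!: ii int x y)
    then have "norm (T x t - T y t) \<le> (LINT s:closed_segment 0 t|lborel. norm (g s (x s) - g s (y s)))"
      using norm_LBINT_le[OF d] by simp
    also have "\<dots> \<le> (LINT s:closed_segment 0 t|lborel. l s * norm (x s - y s))"
    proof (rule set_integral_mono_AE)
      show "AE s\<in>closed_segment 0 t in lborel. norm (g s (x s) - g s (y s)) \<le> l s * norm (x s - y s)"
        using lip by eventually_elim (use t ab in \<open>auto simp: closed_segment_eq_real_ivl split: if_splits\<close>)
    qed (auto intro!: ii set_integrable_norm[OF d] set_integrable_mult_continuous l c)
    finally show ?thesis .
  qed
  obtain \<kappa> where k: "0 < \<kappa>" and w: "\<And>t. t \<in> {a..b} \<Longrightarrow>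
      (LINT s:closed_segment 0 t|lborel. l s * exp (\<kappa> * \<bar>s\<bar>)) \<le> exp (\<kappa> * \<bar>t\<bar>) / 2"
    using exponential_weight[OF l ab] by metis
  define X where "X n = (T ^^ n) (\<lambda>_. x0)" for n
  have X_Suc: "X (Suc n) = T (X n)" for n by (simp add: X_def)
  have X_cont: "continuous_on {a..b} (X n)" for n
    by (induction n) (auto simp: X_Suc T_cont, simp add: X_def)
  obtain M where M: "\<And>s. s \<in> {a..b} \<Longrightarrow> norm (X 1 s - X 0 s) \<le> M"
    using bounded_on_Icc[OF continuous_on_diff[OF X_cont[of 1] X_cont[of 0]]] by blast
  have M0: "0 \<le> M" using order_trans[OF norm_ge_zero M[of 0]] ab by auto
  have step: "norm (X (Suc n) t - X n t) \<le> M / 2 ^ n * exp (\<kappa> * \<bar>t\<bar>)" if "t \<in> {a..b}" for n t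
    using that
  proof (induction n arbitrary: t)
    case 0
    have "M * 1 \<le> M * exp (\<kappa> * \<bar>t\<bar>)" using M0 k by (intro mult_left_mono) auto
    with M[OF 0] show ?case by simp
  next
    case (Suc n)
    have c: "continuous_on {a..b} (\<lambda>s. norm (X (Suc n) s - X n s))"
      by (intro continuous_intros X_cont)
    have "norm (X (Suc (Suc n)) t - X (Suc n) t) \<le>
        (LINT s:closed_segment 0 t|lborel. l s * norm (X (Suc n) s - X n s))"
      using T_diff[OF X_cont[of "Suc n"] X_cont[of n] Suc.prems] by (simp only: X_Suc)
    also have "\<dots> \<le> M / 2 ^ n / 2 * exp (\<kappa> * \<bar>t\<bar>)"
      by (rule weighted_integral_bound[OF l ab w c Suc.IH _ Suc.prems]) (use M0 in auto)
    finally show ?case by (simp add: field_simps)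
  qed
  define W where "W = exp (\<kappa> * (b - a))"
  have step': "norm (X (Suc n) t - X n t) \<le> M * W * (1/2) ^ n" if t: "t \<in> {a..b}" for n t
  proof -
    have "M / 2 ^ n * exp (\<kappa> * \<bar>t\<bar>) \<le> M / 2 ^ n * W"
      unfolding W_def using t ab k M0 by (intro mult_left_mono) (auto intro!: mult_left_mono simp: abs_if)
    with step[OF t, of n] show ?thesis by (simp add: power_divide field_simps)
  qed
  have "uniform_limit {a..b} (\<lambda>n t. \<Sum>i<n. X (Suc i) t - X i t) (\<lambda>t. suminf (\<lambda>i. X (Suc i) t - X i t)) sequentially"
    by (rule Weierstrass_m_test[OF step']) (auto intro!: summable_mult)
  then have "uniform_limit {a..b} (\<lambda>n t. x0 + (\<Sum>i<n. X (Suc i) t - X i t))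
      (\<lambda>t. x0 + suminf (\<lambda>i. X (Suc i) t - X i t)) sequentially"
    by (intro uniform_limit_intros)
  moreover have "x0 + (\<Sum>i<n. X (Suc i) t - X i t) = X n t" for n t
    using sum_lessThan_telescope[of "\<lambda>i. X i t" n] by (simp add: X_def)
  ultimately obtain x where x: "uniform_limit {a..b} X x sequentially" by auto
  have x_cont: "continuous_on {a..b} x"
    by (rule uniform_limit_theorem[OF _ x]) (auto simp: X_cont)
  have "x t = T x t" if t: "t \<in> {a..b}" for t
  proof -
    have c: "continuous_on {a..b} (\<lambda>s. norm (X n s - x s))" for n
      by (intro continuous_intros X_cont x_cont)
    have "(\<lambda>n. T (X n) t) \<longlonglongrightarrow> T x t"
    proof (rule tendstoI)
      fix e :: real assume e: "0 < e"
      have "\<forall>\<^sub>F n in sequentially. \<forall>s\<in>{a..b}. dist (X n s) (x s) < e / W"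
        using uniform_limitD[OF x, of "e / W"] e by (simp add: W_def)
      then show "\<forall>\<^sub>F n in sequentially. dist (T (X n) t) (T x t) < e"
      proof eventually_elim
        case (elim n)
        have "norm (T (X n) t - T x t) \<le> (LINT s:closed_segment 0 t|lborel. l s * norm (X n s - x s))"
          by (rule T_diff[OF X_cont x_cont t])
        also have "\<dots> \<le> e / W / 2 * exp (\<kappa> * \<bar>t\<bar>)"
        proof (rule weighted_integral_bound[OF l ab w c _ _ t])
          fix s assume s: "s \<in> {a..b}"
          have "norm (X n s - x s) \<le> e / W * 1" using elim s by (force simp: dist_norm)
          also have "\<dots> \<le> e / W * exp (\<kappa> * \<bar>s\<bar>)"
            using e k by (intro mult_left_mono) (auto simp: W_def)
          finally show "norm (X n s - x s) \<le> e / W * exp (\<kappa> * \<bar>s\<bar>)" .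
        qed (use e in \<open>auto simp: W_def\<close>)
        also have "\<dots> \<le> e / W / 2 * W"
          unfolding W_def using t ab k e by (intro mult_left_mono) (auto intro!: mult_left_mono simp: abs_if)
        also have "\<dots> < e" using e by (simp add: W_def)
        finally show ?case by (simp add: dist_norm)
      qed
    qed
    moreover have "(\<lambda>n. T (X n) t) \<longlonglongrightarrow> x t"
      using LIMSEQ_Suc[OF tendsto_uniform_limitI[OF x t]] by (simp add: X_Suc)
    ultimately show ?thesis by (rule LIMSEQ_unique[rotated])
  qed
  then have "solves_on g x0 a b x"
    unfolding solves_on_def using x_cont int[OF x_cont] by (simp add: T_def)
  then show thesis by (rule that)
qed

section \<open>Uniqueness and maximal solutions\<close>

lemma segment_subset_interval:
  fixes I :: "real set"
  assumes "is_interval I" "0 \<in> I" "t \<in> I"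
  shows "closed_segment 0 t \<subseteq> I"
  using assms by (simp add: closed_segment_subset is_interval_convex)

lemma norm_solution_diff_le:
  assumes x: "solves_on g x0 a b x" and z: "solves_on h z0 a b z"
    and ab: "a \<le> 0" "0 \<le> b" and t: "t \<in> {a..b}"
  shows "norm (x t - z t) \<le>
    norm (x0 - z0) + (LINT s:closed_segment 0 t|lborel. norm (g s (x s) - h s (z s)))"
proof -
  have i: "set_integrable lborel (closed_segment 0 t) (\<lambda>s. g s (x s))"
    "set_integrable lborel (closed_segment 0 t) (\<lambda>s. h s (z s))"
    using x z by (auto simp: solves_on_def intro: set_integrable_segment[OF _ ab t])
  have "x t - z t = (x0 - z0) + (LBINT s=0..ereal t. g s (x s) - h s (z s))"
    using x z t by (simp add: solves_on_def LBINT_0_diff[OF i, symmetric])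
  then show ?thesis
    using norm_triangle_ineq[of "x0 - z0" "LBINT s=0..ereal t. g s (x s) - h s (z s)"]
      norm_LBINT_le[OF set_integral_diff(1)[OF i]] by simp
qed

lemma caratheodory_imp_solves_on:
  assumes x: "caratheodory_solution g x0 I x" and ab: "a \<le> 0" "0 \<le> b" "{a..b} \<subseteq> I"
  shows "solves_on g x0 a b x"
proof -
  have "a \<in> I" "b \<in> I" using ab by auto
  then have "set_integrable lborel (closed_segment 0 a) (\<lambda>s. g s (x s))"
    "set_integrable lborel (closed_segment 0 b) (\<lambda>s. g s (x s))"
    using x by (auto simp: caratheodory_solution_def interval_integrable_iff_segment[symmetric])
  then have "set_integrable lborel (closed_segment 0 a \<union> closed_segment 0 b) (\<lambda>s. g s (x s))"
    by (rule set_integrable_Un) (simp_all add: closed_segment_eq_real_ivl)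
  also have "closed_segment 0 a \<union> closed_segment 0 b = {a..b}"
    using ab by (auto simp: closed_segment_eq_real_ivl)
  finally show ?thesis
    using x ab by (auto simp: solves_on_def caratheodory_solution_def intro: continuous_on_subset)
qed

lemma solves_on_imp_caratheodory:
  assumes x: "solves_on g x0 a b x" and ab: "a < 0" "0 < b"
  shows "caratheodory_solution g x0 {a<..<b} x"
  unfolding caratheodory_solution_def
proof (intro conjI ballI)
  show "continuous_on {a<..<b} x"
    using x unfolding solves_on_def by (auto intro: continuous_on_subset)
  fix t assume t: "t \<in> {a<..<b}"
  then show "interval_lebesgue_integrable lborel 0 (ereal t) (\<lambda>s. g s (x s))"
    using x ab by (auto simp: solves_on_def interval_integrable_iff_segment
        intro!: set_integrable_segment[of a b])
  show "x t = x0 + (LBINT s=0..ereal t. g s (x s))"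
    using x t by (auto simp: solves_on_def)
qed (use ab in \<open>auto simp: is_interval_oo\<close>)

text \<open>
  The property that forces uniqueness. The set \<open>W\<close> of times allows linear equations whose
  coefficients are integrable only on compact parts of an open interval.
\<close>

definition L1_lipschitz :: "(real \<Rightarrow> 'a::euclidean_space \<Rightarrow> 'a) \<Rightarrow> real set \<Rightarrow> bool" where
  "L1_lipschitz g W \<longleftrightarrow> (\<forall>a b R. a \<le> 0 \<longrightarrow> 0 \<le> b \<longrightarrow> {a..b} \<subseteq> W \<longrightarrow>
     (\<exists>l. set_integrable lborel {a..b} l \<and> (\<forall>t. 0 \<le> l t) \<and>
       (AE t in lborel. t \<in> {a..b} \<longrightarrow>
         (\<forall>x\<in>cball 0 R. \<forall>y\<in>cball 0 R. norm (g t x - g t y) \<le> l t * norm (x - y)))))"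

lemma L1_lipschitzD:
  assumes "L1_lipschitz g W" "a \<le> 0" "0 \<le> b" "{a..b} \<subseteq> W"
  shows "\<exists>l. set_integrable lborel {a..b} l \<and> (\<forall>t. 0 \<le> l t) \<and>
       (AE t in lborel. t \<in> {a..b} \<longrightarrow>
         (\<forall>x\<in>cball 0 R. \<forall>y\<in>cball 0 R. norm (g t x - g t y) \<le> l t * norm (x - y)))"
  using assms unfolding L1_lipschitz_def by blast

text \<open>
  Both solutions stay in one ball, so their distance satisfies Gronwall's inequality with \<open>c = 0\<close>.
\<close>

lemma solves_on_unique:
  assumes g: "L1_lipschitz g W" and W: "{a..b} \<subseteq> W" and ab: "a \<le> 0" "0 \<le> b"
    and x: "solves_on g x0 a b x" and z: "solves_on g x0 a b z" and t: "t \<in> {a..b}"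
  shows "x t = z t"
proof -
  have xc: "continuous_on {a..b} x" and zc: "continuous_on {a..b} z"
    and xi: "set_integrable lborel {a..b} (\<lambda>s. g s (x s))"
    and zi: "set_integrable lborel {a..b} (\<lambda>s. g s (z s))"
    using x z by (auto simp: solves_on_def)
  obtain R1 where R1: "\<And>s. s \<in> {a..b} \<Longrightarrow> norm (x s) \<le> R1" using bounded_on_Icc[OF xc] by blast
  obtain R2 where R2: "\<And>s. s \<in> {a..b} \<Longrightarrow> norm (z s) \<le> R2" using bounded_on_Icc[OF zc] by blast
  have R: "x s \<in> cball 0 (max R1 R2)" "z s \<in> cball 0 (max R1 R2)" if "s \<in> {a..b}" for s
    using R1[OF that] R2[OF that] by simp_all
  obtain l where l: "set_integrable lborel {a..b} l" "\<And>t. 0 \<le> l t"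
    and lip: "AE t in lborel. t \<in> {a..b} \<longrightarrow> (\<forall>x\<in>cball 0 (max R1 R2). \<forall>y\<in>cball 0 (max R1 R2).
       norm (g t x - g t y) \<le> l t * norm (x - y))"
    using L1_lipschitzD[OF g ab W, of "max R1 R2"] by blast
  obtain C where C: "\<forall>c u. continuous_on {a..b} u \<and>
      (\<forall>s\<in>{a..b}. 0 \<le> u s \<and> u s \<le> c + (LINT r:closed_segment 0 s|lborel. l r * u r)) \<longrightarrow>
      (\<forall>t\<in>{a..b}. u t \<le> C * c)"
    using gronwall[OF l ab] by blast
  have c: "continuous_on {a..b} (\<lambda>s. norm (x s - z s))" using xc zc by (intro continuous_intros)
  have "norm (x t - z t) \<le> C * 0"
  proof (rule C[rule_format, OF _ t], intro conjI ballI c norm_ge_zero)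
    fix s assume s: "s \<in> {a..b}"
    have "norm (x s - z s) \<le> (LINT r:closed_segment 0 s|lborel. norm (g r (x r) - g r (z r)))"
      using norm_solution_diff_le[OF x z ab s] by simp
    also have "\<dots> \<le> (LINT r:closed_segment 0 s|lborel. l r * norm (x r - z r))"
    proof (rule set_integral_mono_AE)
      show "set_integrable lborel (closed_segment 0 s) (\<lambda>r. norm (g r (x r) - g r (z r)))"
        by (intro set_integrable_norm set_integral_diff set_integrable_segment[OF _ ab s] xi zi)
      show "set_integrable lborel (closed_segment 0 s) (\<lambda>r. l r * norm (x r - z r))"
        by (intro set_integrable_segment[OF _ ab s] set_integrable_mult_continuous l c)
      have "closed_segment 0 s \<subseteq> {a..b}" using s ab by (auto simp: closed_segment_eq_real_ivl)
      then show "AE r\<in>closed_segment 0 s in lborel. norm (g r (x r) - g r (z r)) \<le> l r * norm (x r - z r)"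
        using lip R by (elim eventually_mono) blast
    qed
    finally show "norm (x s - z s) \<le> 0 + (LINT r:closed_segment 0 s|lborel. l r * norm (x r - z r))"
      by simp
  qed
  then show ?thesis by simp
qed

lemma caratheodory_unique:
  assumes g: "L1_lipschitz g W" and W: "I \<inter> J \<subseteq> W"
    and x: "caratheodory_solution g x0 I x" and z: "caratheodory_solution g x0 J z"
    and t: "t \<in> I" "t \<in> J"
  shows "x t = z t"
proof -
  have I: "is_interval I" "0 \<in> I" and J: "is_interval J" "0 \<in> J"
    using x z by (auto simp: caratheodory_solution_def)
  have "{min 0 t..max 0 t} \<subseteq> I" "{min 0 t..max 0 t} \<subseteq> J"
    using segment_subset_interval[OF I t(1)] segment_subset_interval[OF J t(2)]
    by (simp_all add: closed_segment_eq_real_ivl min_def max_def split: if_splits)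
  then show ?thesis
    using W caratheodory_imp_solves_on[OF x] caratheodory_imp_solves_on[OF z]
    by (intro solves_on_unique[OF g, of "min 0 t" "max 0 t" x0 x z]) auto
qed

lemma caratheodory_cong:
  assumes x: "caratheodory_solution g x0 I x" and eq: "\<And>t. t \<in> I \<Longrightarrow> g t (z t) = g t (x t)"
    and t: "t \<in> I"
  shows "interval_lebesgue_integrable lborel 0 (ereal t) (\<lambda>s. g s (z s))"
    and "(LBINT s=0..ereal t. g s (z s)) = (LBINT s=0..ereal t. g s (x s))"
proof -
  have I: "is_interval I" "0 \<in> I" and i: "interval_lebesgue_integrable lborel 0 (ereal t) (\<lambda>s. g s (x s))"
    using x t by (auto simp: caratheodory_solution_def)
  have S: "closed_segment 0 t \<subseteq> I"
    by (rule segment_subset_interval[OF I t])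
  have "set_integrable lborel (closed_segment 0 t) (\<lambda>s. g s (z s)) \<longleftrightarrow>
      set_integrable lborel (closed_segment 0 t) (\<lambda>s. g s (x s))"
    by (rule set_integrable_cong) (use S eq in auto)
  then show "interval_lebesgue_integrable lborel 0 (ereal t) (\<lambda>s. g s (z s))"
    using i by (simp add: interval_integrable_iff_segment)
  have "einterval (min (ereal 0) (ereal t)) (max (ereal 0) (ereal t)) \<subseteq> closed_segment 0 t"
    by (auto simp: einterval_def closed_segment_eq_real_ivl min_def max_def)
  then show "(LBINT s=0..ereal t. g s (z s)) = (LBINT s=0..ereal t. g s (x s))"
    unfolding zero_ereal_def using S eq by (intro interval_integral_cong) blast
qed

text \<open>
  By uniqueness the solutions on the members of \<open>\<I>\<close> agree where they overlap. This gives the maximal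
  solution, as the union of all solutions, and also solutions of linear equations on open intervals
  from solutions on an exhausting family.
\<close>

lemma caratheodory_glue:
  assumes g: "L1_lipschitz g W" and ne: "\<I> \<noteq> {}"
    and \<I>: "\<And>I. I \<in> \<I> \<Longrightarrow> I \<subseteq> W \<and> (\<exists>x. caratheodory_solution g x0 I x)"
  obtains x where "caratheodory_solution g x0 (\<Union>\<I>) x"
proof -
  obtain X where X: "\<And>I. I \<in> \<I> \<Longrightarrow> caratheodory_solution g x0 I (X I)"
    using \<I> by metis
  define x where "x t = X (SOME I. I \<in> \<I> \<and> t \<in> I) t" for t
  have x: "x t = X I t" if I: "I \<in> \<I>" "t \<in> I" for I t
  proof -
    have "(SOME I. I \<in> \<I> \<and> t \<in> I) \<in> \<I> \<and> t \<in> (SOME I. I \<in> \<I> \<and> t \<in> I)"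
      by (rule someI[of _ I]) (use I in blast)
    then show ?thesis
      unfolding x_def using I \<I> by (intro caratheodory_unique[OF g _ X X]) blast+
  qed
  have "caratheodory_solution g x0 (\<Union>\<I>) x"
    unfolding caratheodory_solution_def
  proof (intro conjI ballI)
    have o: "open I" "connected I" "0 \<in> I" if "I \<in> \<I>" for I
      using X[OF that] by (auto simp: caratheodory_solution_def is_interval_connected_1)
    show "open (\<Union>\<I>)" using o by auto
    show "is_interval (\<Union>\<I>)"
      unfolding is_interval_connected_1
    proof (rule connected_Union)
      show "\<Inter>\<I> \<noteq> {}" using o(3) by blast
    qed (rule o)
    show "0 \<in> \<Union>\<I>" using ne o by auto
    have "continuous_on I x" if I: "I \<in> \<I>" for I
    proof (rule continuous_on_cong[THEN iffD1])
      show "continuous_on I (X I)" using X[OF I] unfolding caratheodory_solution_def by blast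
    qed (use x I in auto)
    then show "continuous_on (\<Union>\<I>) x" by (intro continuous_on_open_Union o)
  next
    fix t assume "t \<in> \<Union>\<I>"
    then obtain I where I: "I \<in> \<I>" "t \<in> I" by blast
    have eq: "g s (x s) = g s (X I s)" if "s \<in> I" for s using x[OF I(1) that] by simp
    show "interval_lebesgue_integrable lborel 0 (ereal t) (\<lambda>s. g s (x s))"
      by (rule caratheodory_cong[OF X[OF I(1)] eq I(2)])
    have "x t = X I t" by (rule x[OF I])
    also have "\<dots> = x0 + (LBINT s=0..ereal t. g s (X I s))"
      using X[OF I(1)] I(2) by (simp add: caratheodory_solution_def)
    also have "(LBINT s=0..ereal t. g s (X I s)) = (LBINT s=0..ereal t. g s (x s))"
      by (rule caratheodory_cong(2)[OF X[OF I(1)] eq I(2), symmetric])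
    finally show "x t = x0 + (LBINT s=0..ereal t. g s (x s))" .
  qed
  then show thesis by (rule that)
qed

text \<open>
  As soon as some solution exists, the definite description behind \<^const>\<open>sol_interval\<close> is
  meaningful: the interval is the union of all intervals that carry a solution.
\<close>

lemma sol_interval_greatest:
  assumes g: "L1_lipschitz g UNIV" and z: "caratheodory_solution g x0 J z"
  shows "caratheodory_solution g x0 (sol_interval g x0) (sol g x0)"
    and "J \<subseteq> sol_interval g x0"
    and "t \<in> J \<Longrightarrow> sol g x0 t = z t"
proof -
  define \<I> where "\<I> = {I. \<exists>x. caratheodory_solution g x0 I x}"
  have J: "J \<in> \<I>" using z by (auto simp: \<I>_def)
  obtain x where x: "caratheodory_solution g x0 (\<Union>\<I>) x"
  proof (rule caratheodory_glue[OF g, of \<I> x0])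
    show "\<I> \<noteq> {}" using J by blast
  qed (auto simp: \<I>_def)
  have max: "maximal_solution g x0 (\<Union>\<I>) x"
    unfolding maximal_solution_def using x by (auto simp: \<I>_def)
  have "sol_interval g x0 = \<Union>\<I>"
    unfolding sol_interval_def
  proof (rule the_equality)
    show "\<exists>x. maximal_solution g x0 (\<Union>\<I>) x" using max by blast
    fix I assume "\<exists>y. maximal_solution g x0 I y"
    then obtain y where y: "maximal_solution g x0 I y" by blast
    then have yc: "caratheodory_solution g x0 I y" by (simp add: maximal_solution_def)
    then have "I \<subseteq> \<Union>\<I>" by (auto simp: \<I>_def)
    moreover have "\<forall>t\<in>I. x t = y t"
      using caratheodory_unique[OF g _ x yc] \<open>I \<subseteq> \<Union>\<I>\<close> by blast
    ultimately show "I = \<Union>\<I>" using y x unfolding maximal_solution_def by blast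
  qed
  then show "J \<subseteq> sol_interval g x0" and
    s: "caratheodory_solution g x0 (sol_interval g x0) (sol g x0)"
    using J x someI[of "caratheodory_solution g x0 (\<Union>\<I>)" x] unfolding sol_def by auto
  then show "sol g x0 t = z t" if "t \<in> J"
    using that by (intro caratheodory_unique[OF g _ s z]) auto
qed

section \<open>Integral bounds along curves\<close>

lemma le_one_plus_powr:
  fixes r p :: real
  assumes "1 \<le> p" "0 \<le> r"
  shows "r \<le> 1 + r powr p"
proof (cases "r \<le> 1")
  case False
  then have "r powr 1 \<le> r powr p" using assms by (intro powr_mono) auto
  then show ?thesis using False by simp
qed (use powr_ge_zero[of r p] in linarith)

text \<open>
  Local \<open>L\<^sup>p\<close> bounds, replaced by everywhere nonnegative ones that are integrable with respect to
  \<^term>\<open>lborel\<close>, the measure with respect to which solutions are defined.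
\<close>

definition Lp_majorant :: "real \<Rightarrow> (real \<Rightarrow> real) \<Rightarrow> bool" where
  "Lp_majorant p m \<longleftrightarrow> (\<forall>t. 0 \<le> m t) \<and>
     (\<forall>a b. set_integrable lborel {a..b} m \<and> set_integrable lborel {a..b} (\<lambda>t. m t powr p))"

lemma Lp_majorantD:
  assumes "Lp_majorant p m"
  shows "0 \<le> m t" "set_integrable lborel {a..b} m" "set_integrable lborel {a..b} (\<lambda>t. m t powr p)"
  using assms by (auto simp: Lp_majorant_def)

lemma Lp_loc_borel_majorant:
  assumes p: "1 \<le> p" and m: "m \<in> Lp_loc p"
  obtains m' where "Lp_majorant p m'" "AE t in lborel. m t \<le> m' t"
proof -
  have ml: "m \<in> borel_measurable (completion lborel)"
    and mi: "\<And>a b. set_integrable lebesgue {a..b} (\<lambda>t. \<bar>m t\<bar> powr p)"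
    using m by (auto simp: Lp_loc_def)
  obtain n where n: "n \<in> borel_measurable lborel" "AE t in lborel. m t = n t"
    using completion_ex_borel_measurable_real[OF ml] by blast
  have n'[measurable]: "n \<in> borel_measurable borel" using n(1) by simp
  have P: "set_integrable lborel {a..b} (\<lambda>t. \<bar>n t\<bar> powr p)" for a b
  proof -
    have meas: "(\<lambda>t. indicator {a..b} t *\<^sub>R (\<bar>n t\<bar> powr p)) \<in> borel_measurable lborel"
      by measurable
    have "AE t in lebesgue. m t = n t" using n(2) by (rule AE_completion)
    then have "AE t in lebesgue. indicator {a..b} t *\<^sub>R (\<bar>m t\<bar> powr p) = indicator {a..b} t *\<^sub>R (\<bar>n t\<bar> powr p)"
      by eventually_elim simp
    then have "integrable lebesgue (\<lambda>t. indicator {a..b} t *\<^sub>R (\<bar>n t\<bar> powr p))"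
      using mi[of a b] measurable_completion[OF meas] unfolding set_integrable_def
      by (subst integrable_cong_AE[symmetric, where f="\<lambda>t. indicator {a..b} t *\<^sub>R (\<bar>m t\<bar> powr p)"])
        (auto dest: borel_measurable_integrable)
    then show ?thesis
      unfolding set_integrable_def using integrable_completion[OF meas] by simp
  qed
  show thesis
  proof (rule that[of "\<lambda>t. \<bar>n t\<bar>"])
    show "AE t in lborel. m t \<le> \<bar>n t\<bar>" using n(2) by eventually_elim simp
    have "set_integrable lborel {a..b} (\<lambda>t. \<bar>n t\<bar>)" for a b
    proof (rule set_integrable_bound)
      show "set_integrable lborel {a..b} (\<lambda>t. 1 + \<bar>n t\<bar> powr p)"
        by (intro set_integral_add P borel_integrable_atLeastAtMost') auto
      show "set_borel_measurable lborel {a..b} (\<lambda>t. \<bar>n t\<bar>)"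
        unfolding set_borel_measurable_def by measurable
      show "AE t in lborel. t \<in> {a..b} \<longrightarrow> norm \<bar>n t\<bar> \<le> norm (1 + \<bar>n t\<bar> powr p)"
        using le_one_plus_powr[OF p] by (auto intro: order_trans[OF _ abs_ge_self])
    qed
    then show "Lp_majorant p (\<lambda>t. \<bar>n t\<bar>)" using P by (simp add: Lp_majorant_def)
  qed
qed

lemma C2_majorant:
  assumes p: "1 \<le> p" and f: "C2 p f"
  obtains m where "Lp_majorant p m" "AE t in lborel. \<forall>x\<in>cball 0 R. norm (f t x) \<le> m t"
proof -
  obtain m where m: "m \<in> Lp_loc p" "AE t in lebesgue. \<forall>x\<in>cball 0 R. norm (f t x) \<le> m t"
    using f compact_cball unfolding C2_def by blast
  obtain m' where m': "Lp_majorant p m'" "AE t in lborel. m t \<le> m' t"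
    using Lp_loc_borel_majorant[OF p m(1)] .
  have "AE t in lborel. \<forall>x\<in>cball 0 R. norm (f t x) \<le> m t" using m(2) by (simp add: AE_completion_iff)
  then have "AE t in lborel. \<forall>x\<in>cball 0 R. norm (f t x) \<le> m' t"
    using m'(2) by eventually_elim (blast intro: order_trans)
  then show thesis using that m' by blast
qed

lemma LC_lipschitz_majorant:
  assumes p: "1 \<le> p" and f: "f \<in> LC p"
  obtains l where "Lp_majorant p l"
    "AE t in lborel. \<forall>x\<in>cball 0 R. \<forall>y\<in>cball 0 R. norm (f t x - f t y) \<le> l t * norm (x - y)"
proof -
  obtain m where m: "m \<in> Lp_loc p"
    "AE t in lebesgue. \<forall>x\<in>cball 0 R. \<forall>y\<in>cball 0 R. norm (f t x - f t y) \<le> m t * norm (x - y)"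
    using f compact_cball unfolding LC_def by blast
  obtain m' where m': "Lp_majorant p m'" "AE t in lborel. m t \<le> m' t"
    using Lp_loc_borel_majorant[OF p m(1)] .
  have "AE t in lborel. \<forall>x\<in>cball 0 R. \<forall>y\<in>cball 0 R. norm (f t x - f t y) \<le> m t * norm (x - y)"
    using m(2) by (simp add: AE_completion_iff)
  then have "AE t in lborel. \<forall>x\<in>cball 0 R. \<forall>y\<in>cball 0 R. norm (f t x - f t y) \<le> m' t * norm (x - y)"
    using m'(2) by eventually_elim (meson mult_right_mono norm_ge_zero order_trans)
  then show thesis using that m' by blast
qed

lemma curve_measurable:
  assumes f: "C1 f" and x: "continuous_on {a..b} x"
  shows "set_borel_measurable lborel {a..b} (\<lambda>t. f t (x t))"
proof -
  have x': "(\<lambda>t. indicator {a..b} t *\<^sub>R x t) \<in> borel_measurable borel"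
    by (rule borel_measurable_continuous_on_indicator[OF _ x]) simp
  have "(\<lambda>t. (\<lambda>(t, x). f t x) (t, indicator {a..b} t *\<^sub>R x t)) \<in> borel_measurable borel"
    using f unfolding C1_def by (rule measurable_compose[rotated]) (intro borel_measurable_Pair x' measurable_ident_sets, simp)
  then have "(\<lambda>t. indicator {a..b} t *\<^sub>R f t (indicator {a..b} t *\<^sub>R x t)) \<in> borel_measurable borel"
    by (intro borel_measurable_scaleR) auto
  also have "(\<lambda>t. indicator {a..b} t *\<^sub>R f t (indicator {a..b} t *\<^sub>R x t)) = (\<lambda>t. indicator {a..b} t *\<^sub>R f t (x t))"
    by (auto simp: indicator_def)
  finally show ?thesis by (simp add: set_borel_measurable_def)
qed

lemma curve_integrable:
  assumes p: "1 \<le> p" and f: "C1 f" "C2 p f" and x: "continuous_on {a..b} x"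
  shows "set_integrable lborel {a..b} (\<lambda>t. f t (x t))"
proof -
  obtain R where R: "\<And>s. s \<in> {a..b} \<Longrightarrow> norm (x s) \<le> R" using bounded_on_Icc[OF x] by blast
  obtain m where m: "Lp_majorant p m" "AE t in lborel. \<forall>x\<in>cball 0 R. norm (f t x) \<le> m t"
    using C2_majorant[OF p f(2), of R] .
  show ?thesis
    by (rule set_integrable_bound[OF Lp_majorantD(2)[OF m(1)] curve_measurable[OF f(1) x]])
      (use m(2) in \<open>eventually_elim, use R Lp_majorantD(1)[OF m(1)] in auto\<close>)
qed

lemma powr_add_le:
  fixes r s p :: real
  assumes "0 \<le> r" "0 \<le> s" "1 \<le> p"
  shows "(r + s) powr p \<le> 2 powr p * (r powr p + s powr p)"
proof -
  have "(r + s) powr p \<le> (2 * max r s) powr p" using assms by (intro powr_mono2) auto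
  also have "\<dots> = 2 powr p * max r s powr p" using assms by (intro powr_mult)
  also have "\<dots> \<le> 2 powr p * (r powr p + s powr p)" by (intro mult_left_mono) (auto simp: max_def)
  finally show ?thesis .
qed

text \<open>
  The bound \<open>B\<close> is uniform over all curves in the ball. Hence the supremum in \<^const>\<open>Theta_seminorm\<close>
  is one of a bounded set, which is what makes it an upper bound of its members.
\<close>

lemma curve_diff_powr:
  fixes f g :: "real \<Rightarrow> 'a::euclidean_space \<Rightarrow> 'b::euclidean_space"
  assumes p: "1 \<le> p" and f: "C1 f" "C2 p f" and g: "C1 g" "C2 p g"
  shows "\<exists>B. \<forall>x y. continuous_on {a..b} x \<longrightarrow> x ` {a..b} \<subseteq> cball 0 R \<longrightarrow>
      continuous_on {a..b} y \<longrightarrow> y ` {a..b} \<subseteq> cball 0 R \<longrightarrow>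
      set_integrable lborel {a..b} (\<lambda>t. norm (f t (x t) - g t (y t)) powr p) \<and>
      (LINT t:{a..b}|lborel. norm (f t (x t) - g t (y t)) powr p) \<le> B"
proof -
  obtain m where m: "Lp_majorant p m" "AE t in lborel. \<forall>x\<in>cball 0 R. norm (f t x) \<le> m t"
    using C2_majorant[OF p f(2), of R] .
  obtain n where n: "Lp_majorant p n" "AE t in lborel. \<forall>x\<in>cball 0 R. norm (g t x) \<le> n t"
    using C2_majorant[OF p g(2), of R] .
  let ?M = "\<lambda>t. 2 powr p * (m t powr p + n t powr p)"
  have M: "set_integrable lborel {a..b} ?M"
    by (intro set_integrable_mult_right set_integral_add Lp_majorantD m(1) n(1))
  show ?thesis
  proof (intro exI[of _ "LINT t:{a..b}|lborel. ?M t"] allI impI)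
    fix x y :: "real \<Rightarrow> 'a"
    assume x: "continuous_on {a..b} x" "x ` {a..b} \<subseteq> cball 0 R"
      and y: "continuous_on {a..b} y" "y ` {a..b} \<subseteq> cball 0 R"
    have le: "AE t in lborel. t \<in> {a..b} \<longrightarrow> norm (f t (x t) - g t (y t)) powr p \<le> ?M t"
      using m(2) n(2)
    proof eventually_elim
      case (elim t)
      show ?case
      proof
        assume t: "t \<in> {a..b}"
        then have "norm (f t (x t)) \<le> m t" "norm (g t (y t)) \<le> n t" using elim x y by blast+
        then have "norm (f t (x t) - g t (y t)) \<le> m t + n t"
          using norm_triangle_ineq4[of "f t (x t)" "g t (y t)"] by linarith
        then have "norm (f t (x t) - g t (y t)) powr p \<le> (m t + n t) powr p"
          using p by (intro powr_mono2) auto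
        also have "\<dots> \<le> ?M t" by (rule powr_add_le[OF Lp_majorantD(1)[OF m(1)] Lp_majorantD(1)[OF n(1)] p])
        finally show "norm (f t (x t) - g t (y t)) powr p \<le> ?M t" .
      qed
    qed
    have "set_integrable lborel {a..b} (\<lambda>t. norm (f t (x t) - g t (y t)) powr p)"
    proof (rule set_integrable_bound[OF M])
      have "(\<lambda>t. norm (indicator {a..b} t *\<^sub>R f t (x t) - indicator {a..b} t *\<^sub>R g t (y t)) powr p) \<in> borel_measurable lborel"
        using curve_measurable[OF f(1) x(1)] curve_measurable[OF g(1) y(1)]
        unfolding set_borel_measurable_def by measurable
      also have "(\<lambda>t. norm (indicator {a..b} t *\<^sub>R f t (x t) - indicator {a..b} t *\<^sub>R g t (y t)) powr p) =
          (\<lambda>t. indicator {a..b} t *\<^sub>R norm (f t (x t) - g t (y t)) powr p)"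
        using p by (auto simp: indicator_def)
      finally show "set_borel_measurable lborel {a..b} (\<lambda>t. norm (f t (x t) - g t (y t)) powr p)"
        by (simp add: set_borel_measurable_def)
      show "AE t in lborel. t \<in> {a..b} \<longrightarrow> norm (norm (f t (x t) - g t (y t)) powr p) \<le> norm (?M t)"
        using le by eventually_elim auto
    qed
    then show "set_integrable lborel {a..b} (\<lambda>t. norm (f t (x t) - g t (y t)) powr p) \<and>
      (LINT t:{a..b}|lborel. norm (f t (x t) - g t (y t)) powr p) \<le> (LINT t:{a..b}|lborel. ?M t)"
      using set_integral_mono_AE[OF _ M] le by blast
  qed
qed

text \<open>
  The inequality \<open>r \<le> d + d\<^bsup>1-p\<^esup> r\<^sup>p\<close>, for \<open>r \<ge> 0\<close> and \<open>d > 0\<close>, takes the place of Hoelder's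
  inequality: the interval has finite length, so the constant \<open>d\<close> has a small integral.
\<close>

lemma Lp_null_imp_L1_null:
  fixes u :: "nat \<Rightarrow> real \<Rightarrow> real"
  assumes p: "1 \<le> p" and ab: "a \<le> b" and u0: "\<And>n t. 0 \<le> u n t"
    and int: "\<And>n. set_integrable lborel {a..b} (u n)" "\<And>n. set_integrable lborel {a..b} (\<lambda>t. u n t powr p)"
    and lim: "(\<lambda>n. LINT t:{a..b}|lborel. u n t powr p) \<longlonglongrightarrow> 0"
  shows "(\<lambda>n. LINT t:{a..b}|lborel. u n t) \<longlonglongrightarrow> 0"
proof (rule order_tendstoI)
  fix e :: real assume "e < 0"
  moreover have "0 \<le> (LINT t:{a..b}|lborel. u n t)" for n
    unfolding set_lebesgue_integral_def using u0 by (intro integral_nonneg_AE) auto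
  ultimately show "\<forall>\<^sub>F n in sequentially. e < (LINT t:{a..b}|lborel. u n t)"
    by (intro always_eventually) (auto intro: less_le_trans)
next
  fix e :: real assume e: "0 < e"
  \<comment> \<open>With this \<open>d\<close> the constant part of the bound integrates to less than \<open>e/2\<close>.\<close>
  define k where "k = b - a + 1"
  have k: "0 < k" using ab by (simp add: k_def)
  define d where "d = e / (2 * k)"
  have d: "0 < d" using e k by (simp add: d_def)
  have "(\<lambda>n. d * (b - a) + d powr (1 - p) * (LINT t:{a..b}|lborel. u n t powr p)) \<longlonglongrightarrow>
      d * (b - a) + d powr (1 - p) * 0"
    by (intro tendsto_intros lim)
  moreover have "d * (b - a) + d powr (1 - p) * 0 < e"
  proof -
    have "d * (b - a) \<le> d * k" using d by (simp add: k_def)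
    also have "\<dots> = e / 2" using k by (simp add: d_def)
    finally show ?thesis using e by simp
  qed
  ultimately have "\<forall>\<^sub>F n in sequentially.
      d * (b - a) + d powr (1 - p) * (LINT t:{a..b}|lborel. u n t powr p) < e"
    by (rule order_tendstoD)
  then show "\<forall>\<^sub>F n in sequentially. (LINT t:{a..b}|lborel. u n t) < e"
  proof eventually_elim
    case (elim n)
    have const: "set_integrable lborel {a..b} (\<lambda>t. d)" by (intro borel_integrable_atLeastAtMost') auto
    have "(LINT t:{a..b}|lborel. u n t) \<le> (LINT t:{a..b}|lborel. d + d powr (1 - p) * (u n t powr p))"
    proof (rule set_integral_mono[OF int(1)])
      show "set_integrable lborel {a..b} (\<lambda>t. d + d powr (1 - p) * (u n t powr p))"
        by (intro set_integral_add const set_integrable_mult_right int)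
      fix t
      show "u n t \<le> d + d powr (1 - p) * (u n t powr p)"
      proof (cases "u n t \<le> d")
        case True
        have "0 \<le> d powr (1 - p) * (u n t powr p)" by simp
        then show ?thesis using True by linarith
      next
        case False
        have "u n t = u n t powr (1 - p) * u n t powr p"
          using False d by (simp flip: powr_add)
        also have "\<dots> \<le> d powr (1 - p) * u n t powr p"
          using False d p by (intro mult_right_mono powr_mono2') auto
        finally show ?thesis using d by linarith
      qed
    qed
    also have "\<dots> = d * (b - a) + d powr (1 - p) * (LINT t:{a..b}|lborel. u n t powr p)"
    proof -
      have "(LINT t:{a..b}|lborel. d) = d * (b - a)"
        using ab by (simp add: set_integral_const mult.commute)
      then show ?thesis
        by (subst set_integral_add(2)[OF const set_integrable_mult_right[OF int(2)]]) simp
    qed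
    finally show ?case using elim by linarith
  qed
qed

section \<open>Convergence in the topology of the seminorms\<close>

lemma Theta_seminorm_upper:
  fixes f g :: "real \<Rightarrow> 'a::euclidean_space \<Rightarrow> 'b::euclidean_space"
  assumes p: "1 \<le> p" and f: "C1 f" "C2 p f" and g: "C1 g" "C2 p g" and w: "w \<in> moduli_set \<Theta> q1 q2 j"
  shows "(LINT t:{q1..q2}|lborel. norm (f t (w t) - g t (w t)) powr p) powr (1 / p) \<le>
    Theta_seminorm \<Theta> p q1 q2 j (\<lambda>t x. f t x - g t x)"
proof -
  obtain B where B: "\<forall>x y. continuous_on {q1..q2} x \<longrightarrow> x ` {q1..q2} \<subseteq> cball 0 (real j) \<longrightarrow>
      continuous_on {q1..q2} y \<longrightarrow> y ` {q1..q2} \<subseteq> cball 0 (real j) \<longrightarrow>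
      set_integrable lborel {q1..q2} (\<lambda>t. norm (f t (x t) - g t (y t)) powr p) \<and>
      (LINT t:{q1..q2}|lborel. norm (f t (x t) - g t (y t)) powr p) \<le> B"
    using curve_diff_powr[OF p f g, of q1 q2 "real j"] by blast
  show ?thesis
    unfolding Theta_seminorm_def
  proof (rule cSUP_upper[OF w], rule bdd_aboveI2)
    fix x :: "real \<Rightarrow> 'a" assume x: "x \<in> moduli_set \<Theta> q1 q2 j"
    have "0 \<le> (LINT t:{q1..q2}|lborel. norm (f t (x t) - g t (x t)) powr p)"
      unfolding set_lebesgue_integral_def by (intro integral_nonneg_AE) auto
    then show "(LINT t:{q1..q2}|lborel. norm (f t (x t) - g t (x t)) powr p) powr (1 / p) \<le> B powr (1 / p)"
      using B[rule_format, of x x] x p by (intro powr_mono2) (auto simp: moduli_set_def)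
  qed
qed

text \<open>
  The curves may vary with \<open>n\<close>: the seminorm is a supremum over all curves with the given modulus of
  continuity, so closeness in the seminorm is closeness along each of them at once.
\<close>

lemma T_Theta_tendsto_along_curves:
  fixes gs :: "nat \<Rightarrow> real \<Rightarrow> 'a::euclidean_space \<Rightarrow> 'b::euclidean_space"
  assumes p: "1 \<le> p" and X: "\<And>f. f \<in> X \<Longrightarrow> C1 f \<and> C2 p f"
    and lim: "limitin (T_Theta \<Theta> p X) gs g sequentially" and gs: "\<And>n. gs n \<in> X"
    and w: "\<And>n. w n \<in> moduli_set \<Theta> q1 q2 j" and q: "q1 \<in> \<rat>" "q2 \<in> \<rat>" "q1 \<le> q2"
  shows "(\<lambda>n. LINT t:{q1..q2}|lborel. norm (gs n t (w n t) - g t (w n t)) powr p) \<longlonglongrightarrow> 0"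
proof (rule order_tendstoI)
  let ?I = "\<lambda>n. LINT t:{q1..q2}|lborel. norm (gs n t (w n t) - g t (w n t)) powr p"
  have nonneg: "0 \<le> ?I n" for n
    unfolding set_lebesgue_integral_def by (intro integral_nonneg_AE) auto
  then show "\<forall>\<^sub>F n in sequentially. e < ?I n" if "e < 0" for e
    using that by (intro always_eventually) (auto intro: less_le_trans)
  fix e :: real assume e: "0 < e"
  have g: "g \<in> X" using lim by (auto simp: limitin_def)
  let ?U = "{h \<in> X. Theta_seminorm \<Theta> p q1 q2 j (\<lambda>t x. h t x - g t x) < e powr (1 / p)}"
  have "openin (T_Theta \<Theta> p X) ?U"
    unfolding T_Theta_def using g q e
    by (intro topology_generated_by_Basis CollectI exI[of _ g] exI[of _ q1] exI[of _ q2] exI[of _ j]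
        exI[of _ "e powr (1 / p)"]) simp
  moreover have "g \<in> ?U"
  proof -
    have "moduli_set \<Theta> q1 q2 j \<noteq> ({} :: (real \<Rightarrow> 'a) set)" using w by blast
    then have "Theta_seminorm \<Theta> p q1 q2 j (\<lambda>t x. g t x - g t x) = 0"
      using p by (simp add: Theta_seminorm_def)
    then show ?thesis using g e by simp
  qed
  ultimately have "\<forall>\<^sub>F n in sequentially. gs n \<in> ?U" using lim by (auto simp: limitin_def)
  then show "\<forall>\<^sub>F n in sequentially. ?I n < e"
  proof eventually_elim
    case (elim n)
    have "?I n powr (1 / p) \<le> Theta_seminorm \<Theta> p q1 q2 j (\<lambda>t x. gs n t x - g t x)"
      using Theta_seminorm_upper[OF p _ _ _ _ w] X[OF gs] X[OF g] by blast
    also have "\<dots> < e powr (1 / p)" using elim by simp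
    finally show ?case
      using e p powr_mono2[of "1 / p" e "?I n"] by (intro not_le_imp_less notI) auto
  qed
qed

lemma T_Theta_L1_tendsto_along_curves:
  fixes gs :: "nat \<Rightarrow> real \<Rightarrow> 'a::euclidean_space \<Rightarrow> 'b::euclidean_space"
  assumes p: "1 \<le> p" and X: "\<And>f. f \<in> X \<Longrightarrow> C1 f \<and> C2 p f"
    and lim: "limitin (T_Theta \<Theta> p X) gs g sequentially" and gs: "\<And>n. gs n \<in> X"
    and w: "\<And>n. w n \<in> moduli_set \<Theta> q1 q2 j" and q: "q1 \<in> \<rat>" "q2 \<in> \<rat>" "q1 \<le> q2"
  shows "(\<lambda>n. LINT t:{q1..q2}|lborel. norm (gs n t (w n t) - g t (w n t))) \<longlonglongrightarrow> 0"
proof (rule Lp_null_imp_L1_null[OF p q(3) norm_ge_zero])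
  have g: "C1 g" "C2 p g" using lim X by (auto simp: limitin_def)
  have gs': "C1 (gs n)" "C2 p (gs n)" for n using X gs by auto
  have w': "continuous_on {q1..q2} (w n)" "w n ` {q1..q2} \<subseteq> cball 0 (real j)" for n
    using w by (auto simp: moduli_set_def)
  fix n
  show "set_integrable lborel {q1..q2} (\<lambda>t. norm (gs n t (w n t) - g t (w n t)))"
    by (rule set_integrable_norm[OF set_integral_diff(1)[OF curve_integrable[OF p gs' w'(1)]
          curve_integrable[OF p g w'(1)]]])
  show "set_integrable lborel {q1..q2} (\<lambda>t. norm (gs n t (w n t) - g t (w n t)) powr p)"
    using curve_diff_powr[OF p gs'(1,2)[of n] g, of q1 q2 "real j"] w'[of n] by blast
qed (rule T_Theta_tendsto_along_curves[OF assms])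

section \<open>Existence of solutions\<close>

lemma solves_on_initial: "solves_on g x0 a b x \<Longrightarrow> a \<le> 0 \<Longrightarrow> 0 \<le> b \<Longrightarrow> x 0 = x0"
  unfolding solves_on_def by (auto simp flip: zero_ereal_def)

lemma solves_on_cong:
  assumes x: "solves_on g x0 a b x" and ab: "a \<le> a'" "a' \<le> 0" "0 \<le> b'" "b' \<le> b"
    and eq: "\<And>t. t \<in> {a'..b'} \<Longrightarrow> h t (x t) = g t (x t)"
  shows "solves_on h x0 a' b' x"
  unfolding solves_on_def
proof (intro conjI ballI)
  have S: "{a'..b'} \<subseteq> {a..b}" using ab by auto
  show "continuous_on {a'..b'} x" using x S continuous_on_subset unfolding solves_on_def by blast
  have "set_integrable lborel {a'..b'} (\<lambda>s. g s (x s))"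
    using x unfolding solves_on_def by (auto intro: set_integrable_subset[OF _ _ S])
  then show "set_integrable lborel {a'..b'} (\<lambda>s. h s (x s))"
    by (rule set_integrable_cong[THEN iffD1, rotated -1]) (use eq in auto)
  fix t assume t: "t \<in> {a'..b'}"
  have "einterval (min (ereal 0) (ereal t)) (max (ereal 0) (ereal t)) \<subseteq> {a'..b'}"
    using t ab by (auto simp: einterval_def min_def max_def split: if_splits)
  then have "(LBINT s=0..ereal t. h s (x s)) = (LBINT s=0..ereal t. g s (x s))"
    unfolding zero_ereal_def using eq by (intro interval_integral_cong) blast
  then show "x t = x0 + (LBINT s=0..ereal t. h s (x s))"
    using x t S unfolding solves_on_def by auto
qed

text \<open>
  The nearest-point projection onto a ball. It is 1-Lipschitz, so it preserves moduli of continuity,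
  and the identity on the ball.
\<close>

abbreviation truncate :: "real \<Rightarrow> 'a::euclidean_space \<Rightarrow> 'a" where
  "truncate R \<equiv> closest_point (cball 0 R)"

lemma truncate_in_cball: "0 \<le> R \<Longrightarrow> truncate R v \<in> cball 0 R"
  by (rule closest_point_in_set) auto

lemma norm_truncate_diff_le: "0 \<le> R \<Longrightarrow> norm (truncate R v - truncate R w) \<le> norm (v - w)"
  using closest_point_lipschitz[of "cball 0 R" v w] by (simp add: dist_norm)

lemma continuous_on_truncate: "0 \<le> R \<Longrightarrow> continuous_on A x \<Longrightarrow> continuous_on A (\<lambda>t. truncate R (x t))"
  by (rule continuous_on_compose2[OF continuous_on_closest_point[of "cball 0 R" UNIV]]) auto

text \<open>
  Composed with the projection, the right-hand side becomes globally Lipschitz and bounded, with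
  integrable bounds.
\<close>

lemma truncated_solution_exists:
  assumes p: "1 \<le> p" and f: "f \<in> LC p" and ab: "a \<le> 0" "0 \<le> b" and R: "0 \<le> R"
  obtains z where "solves_on (\<lambda>t v. f t (truncate R v)) x0 a b z"
proof -
  have f': "C1 f" "C2 p f" using f by (auto simp: LC_def)
  obtain m where m: "Lp_majorant p m" "AE t in lborel. \<forall>x\<in>cball 0 R. norm (f t x) \<le> m t"
    using C2_majorant[OF p f'(2), of R] .
  obtain l where l: "Lp_majorant p l"
    "AE t in lborel. \<forall>x\<in>cball 0 R. \<forall>y\<in>cball 0 R. norm (f t x - f t y) \<le> l t * norm (x - y)"
    using LC_lipschitz_majorant[OF p f, of R] .
  show thesis
  proof (rule picard[OF ab, of "\<lambda>t v. f t (truncate R v)" l m x0])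
    show "set_borel_measurable lborel {a..b} (\<lambda>t. f t (truncate R (x t)))"
      if "continuous_on {a..b} x" for x
      by (rule curve_measurable[OF f'(1) continuous_on_truncate[OF R that]])
    show "AE t in lborel. t \<in> {a..b} \<longrightarrow>
      (\<forall>x y. norm (f t (truncate R x) - f t (truncate R y)) \<le> l t * norm (x - y))"
      using l(2)
    proof eventually_elim
      case (elim t)
      have "norm (f t (truncate R x) - f t (truncate R y)) \<le> l t * norm (x - y)" for x y
      proof -
        have "norm (f t (truncate R x) - f t (truncate R y)) \<le> l t * norm (truncate R x - truncate R y)"
          using elim truncate_in_cball[OF R] by blast
        also have "\<dots> \<le> l t * norm (x - y)"
          by (intro mult_left_mono norm_truncate_diff_le R Lp_majorantD(1)[OF l(1)])
        finally show ?thesis .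
      qed
      then show ?case by blast
    qed
    show "AE t in lborel. t \<in> {a..b} \<longrightarrow> norm (f t (truncate R 0)) \<le> m t"
      using m(2) by eventually_elim (use truncate_in_cball[OF R] in blast)
  qed (use that Lp_majorantD[OF m(1)] Lp_majorantD[OF l(1)] in blast)+
qed

lemma LC_imp_L1_lipschitz:
  assumes p: "1 \<le> p" and f: "f \<in> LC p"
  shows "L1_lipschitz f UNIV"
  unfolding L1_lipschitz_def
proof (intro allI impI)
  fix a b R :: real
  obtain l where l: "Lp_majorant p l"
    "AE t in lborel. \<forall>x\<in>cball 0 R. \<forall>y\<in>cball 0 R. norm (f t x - f t y) \<le> l t * norm (x - y)"
    using LC_lipschitz_majorant[OF p f, of R] .
  then show "\<exists>l. set_integrable lborel {a..b} l \<and> (\<forall>t. 0 \<le> l t) \<and>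
       (AE t in lborel. t \<in> {a..b} \<longrightarrow>
         (\<forall>x\<in>cball 0 R. \<forall>y\<in>cball 0 R. norm (f t x - f t y) \<le> l t * norm (x - y)))"
    by (intro exI[of _ l] conjI allI Lp_majorantD[OF l(1)]) (auto elim: eventually_mono)
qed

text \<open>
  A solution of the truncated equation solves the original one for as long as it stays in the ball,
  which it does for a short time since the radius exceeds \<open>|x\<^sub>0|\<close>.
\<close>

lemma LC_local_solution:
  assumes p: "1 \<le> p" and f: "f \<in> LC p"
  obtains J z where "caratheodory_solution f x0 J z"
proof -
  define R where "R = norm x0 + 1"
  have R: "0 \<le> R" by (simp add: R_def)
  obtain z where z: "solves_on (\<lambda>t v. f t (truncate R v)) x0 (-1) 1 z"
    by (rule truncated_solution_exists[OF p f _ _ R, of "-1" 1 x0]) auto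
  have z0: "z 0 = x0" by (rule solves_on_initial[OF z]) auto
  have "continuous_on {-1..1} z" using z by (simp add: solves_on_def)
  then obtain d where d: "0 < d" "\<And>t. t \<in> {-1..1} \<Longrightarrow> dist t 0 < d \<Longrightarrow> dist (z t) (z 0) < 1"
    unfolding continuous_on_iff by (metis atLeastAtMost_iff neg_le_0_iff_le zero_le_one zero_less_one)
  define c where "c = min (d / 2) 1"
  have c: "0 < c" "c \<le> 1" "c < d" using d(1) by (auto simp: c_def)
  have "solves_on f x0 (- c) c z"
  proof (rule solves_on_cong[OF z])
    fix t assume t: "t \<in> {-c..c}"
    have "dist (z t) (z 0) < 1" by (rule d(2)) (use t c in \<open>auto simp: dist_real_def\<close>)
    then have "z t \<in> cball 0 R"
      using norm_triangle_sub[of "z t" x0] by (simp add: z0 R_def dist_norm)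
    then show "f t (z t) = f t (truncate R (z t))" by (simp add: closest_point_self)
  qed (use c in auto)
  then have "caratheodory_solution f x0 {-c<..<c} z"
    using c by (intro solves_on_imp_caratheodory) auto
  then show thesis by (rule that)
qed

lemma LC_sol:
  assumes p: "1 \<le> p" and f: "f \<in> LC p"
  shows "caratheodory_solution f x0 (sol_interval f x0) (sol f x0)"
proof -
  obtain J z where "caratheodory_solution f x0 J z" using LC_local_solution[OF p f] .
  then show ?thesis by (rule sol_interval_greatest(1)[OF LC_imp_L1_lipschitz[OF p f]])
qed

text \<open>
  The seminorms refer to intervals with rational endpoints only. The strict inclusion of \<open>[T\<^sub>1, T\<^sub>2]\<close>
  is needed because a solution on \<open>[q\<^sub>1, q\<^sub>2]\<close> gives a Caratheodory solution on the open interval.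
\<close>

lemma rational_enclosure:
  fixes I :: "real set"
  assumes I: "open I" "is_interval I" "0 \<in> I" and T: "{T1..T2} \<subseteq> I" "T1 \<le> T2"
  obtains q1 q2 where "q1 \<in> \<rat>" "q2 \<in> \<rat>" "q1 < 0" "0 < q2" "q1 < T1" "T2 < q2" "{q1..q2} \<subseteq> I"
proof -
  have "min 0 T1 \<in> I" "max 0 T2 \<in> I" using I T by (auto simp: min_def max_def)
  then obtain d e where d: "0 < d" "ball (min 0 T1) d \<subseteq> I" and e: "0 < e" "ball (max 0 T2) e \<subseteq> I"
    using I(1) open_contains_ball by meson
  obtain q1 where q1: "q1 \<in> \<rat>" "min 0 T1 - d < q1" "q1 < min 0 T1"
  proof -
    have "min 0 T1 - d < min 0 T1" using d(1) by linarith
    then show thesis using Rats_dense_in_real that by blast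
  qed
  obtain q2 where q2: "q2 \<in> \<rat>" "max 0 T2 < q2" "q2 < max 0 T2 + e"
  proof -
    have "max 0 T2 < max 0 T2 + e" using e(1) by linarith
    then show thesis using Rats_dense_in_real that by blast
  qed
  have "q1 \<in> ball (min 0 T1) d" "q2 \<in> ball (max 0 T2) e"
    using q1(2,3) q2(2,3) unfolding mem_ball dist_real_def by linarith+
  then have "q1 \<in> I" "q2 \<in> I" using d(2) e(2) by blast+
  then have "{q1..q2} \<subseteq> I" using I(2) unfolding is_interval_1 by fastforce
  moreover have "q1 < 0 \<and> q1 < T1" "0 < q2 \<and> T2 < q2" using q1(3) q2(2) by linarith+
  ultimately show thesis using q1(1) q2(1) by (intro that[of q1 q2]) simp_all
qed

section \<open>Moduli of continuity of solutions\<close>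

text \<open>
  The moduli of continuity are designed for this: along any curve in the ball, \<open>|f|\<close> is below the
  optimal m-bound.
\<close>

lemma norm_integral_le_moduli_of:
  assumes E: "E \<subseteq> LC p" "L1loc_equicontinuous_m_bounds E" and p: "1 \<le> p" and f: "f \<in> E"
    and v: "continuous_on {q1..q2} v" "v ` {q1..q2} \<subseteq> cball 0 (real j)"
    and st: "q1 \<le> s" "s \<le> t" "t \<le> q2"
  shows "norm (LINT u:{s..t}|lborel. f u (v u)) \<le> moduli_of E q1 q2 j (t - s)"
proof -
  have f': "C1 f" "C2 p f" using f E by (auto simp: LC_def)
  have S: "{s..t} \<subseteq> {q1..q2}" using st by auto
  have i: "set_integrable lborel {s..t} (\<lambda>u. f u (v u))"
    by (rule curve_integrable[OF p f' continuous_on_subset[OF v(1) S]])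
  have "ennreal (norm (LINT u:{s..t}|lborel. f u (v u))) \<le> ennreal (LINT u:{s..t}|lborel. norm (f u (v u)))"
    by (intro ennreal_leI set_integral_norm_bound i)
  also have "\<dots> = (\<integral>\<^sup>+u. ennreal (indicator {s..t} u *\<^sub>R norm (f u (v u))) \<partial>lborel)"
    unfolding set_lebesgue_integral_def
    using set_integrable_norm[OF i] by (intro nn_integral_eq_integral[symmetric]) (auto simp: set_integrable_def)
  also have "\<dots> = (\<integral>\<^sup>+u. ennreal (indicator {s..t} u *\<^sub>R norm (f u (v u))) \<partial>lebesgue)"
    by (simp add: nn_integral_completion)
  also have "\<dots> \<le> (\<integral>\<^sup>+u\<in>{s..s + (t - s)}. opt_m_bound f j u \<partial>lebesgue)"
  proof (rule nn_integral_mono)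
    fix u
    have "ennreal (norm (f u (v u))) \<le> opt_m_bound f j u" if "u \<in> {s..t}"
      unfolding opt_m_bound_def by (rule SUP_upper) (use that S v in blast)
    then show "ennreal (indicator {s..t} u *\<^sub>R norm (f u (v u))) \<le>
        opt_m_bound f j u * indicator {s..s + (t - s)} u"
      by (auto simp: indicator_def)
  qed
  also have "\<dots> \<le> (SUP a\<in>{q1..q2}. SUP f\<in>E. \<integral>\<^sup>+u\<in>{a..a + (t - s)}. opt_m_bound f j u \<partial>lebesgue)"
    by (rule SUP_upper2[of s], use st in simp, rule SUP_upper[OF f])
  finally have "enn2real (ennreal (norm (LINT u:{s..t}|lborel. f u (v u)))) \<le>
      enn2real (SUP a\<in>{q1..q2}. SUP f\<in>E. \<integral>\<^sup>+u\<in>{a..a + (t - s)}. opt_m_bound f j u \<partial>lebesgue)"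
    by (rule enn2real_mono) (use moduli_of_finite[OF E] st in simp)
  then show ?thesis by (simp add: moduli_of_def)
qed

text \<open>
  With \<open>P\<close> the projection onto the ball, this applies to truncated equations; their solutions may leave
  the ball, and still have the modulus of continuity that belongs to it.
\<close>

lemma norm_solution_diff_le_moduli_of:
  assumes E: "E \<subseteq> LC p" "L1loc_equicontinuous_m_bounds E" and p: "1 \<le> p" and f: "f \<in> E"
    and q: "q1 \<le> 0" "0 \<le> q2"
    and z: "solves_on (\<lambda>t v. f t (P v)) x0 q1 q2 z"
    and v: "continuous_on {q1..q2} (\<lambda>t. P (z t))" "\<And>t. t \<in> {q1..q2} \<Longrightarrow> P (z t) \<in> cball 0 (real j)"
    and st: "s \<in> {q1..q2}" "t \<in> {q1..q2}"
  shows "norm (z s - z t) \<le> moduli_of E q1 q2 j \<bar>s - t\<bar>"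
proof -
  have *: "norm (z t - z s) \<le> moduli_of E q1 q2 j (t - s)"
    if "s \<in> {q1..q2}" "t \<in> {q1..q2}" "s \<le> t" for s t
  proof -
    have i: "set_integrable lborel {q1..q2} (\<lambda>u. f u (P (z u)))" using z by (simp add: solves_on_def)
    have "z t - z s = (LINT u:{s..t}|lborel. f u (P (z u)))"
      using LBINT_diff[OF i q that] z that by (simp add: solves_on_def)
    moreover have "(\<lambda>t. P (z t)) ` {q1..q2} \<subseteq> cball 0 (real j)" using v(2) by blast
    ultimately show ?thesis
      using norm_integral_le_moduli_of[OF E p f v(1), of j s t] that by simp
  qed
  show ?thesis
    using *[OF st] *[OF st(2,1)] by (cases "s \<le> t") (simp_all add: norm_minus_commute)
qed

lemma solution_in_moduli_set:
  assumes E: "E \<subseteq> LC p" "L1loc_equicontinuous_m_bounds E" and p: "1 \<le> p" and f: "f \<in> E"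
    and q: "q1 \<le> 0" "0 \<le> q2" and z: "solves_on f x0 q1 q2 z"
    and j: "\<And>t. t \<in> {q1..q2} \<Longrightarrow> norm (z t) \<le> real j"
  shows "z \<in> moduli_set (moduli_of E) q1 q2 j"
  using norm_solution_diff_le_moduli_of[OF E p f q, where P="\<lambda>v. v", OF z] z j
  by (auto simp: moduli_set_def solves_on_def)

lemma moduli_set_limit:
  assumes z: "\<forall>\<^sub>F n in sequentially. z n \<in> moduli_set \<Theta> q1 q2 j"
    and lim: "uniform_limit {q1..q2} z x sequentially"
  shows "x \<in> moduli_set \<Theta> q1 q2 j"
proof -
  have pt: "(\<lambda>n. z n t) \<longlonglongrightarrow> x t" if "t \<in> {q1..q2}" for t by (rule tendsto_uniform_limitI[OF lim that])
  have "continuous_on {q1..q2} x"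
    by (rule uniform_limit_theorem[OF _ lim]) (use z in \<open>auto simp: moduli_set_def elim: eventually_mono\<close>)
  moreover have "norm (x t) \<le> real j" if t: "t \<in> {q1..q2}" for t
  proof (rule tendsto_upperbound[OF tendsto_norm[OF pt[OF t]]])
    show "\<forall>\<^sub>F n in sequentially. norm (z n t) \<le> real j"
      using z by eventually_elim (use t in \<open>fastforce simp: moduli_set_def\<close>)
  qed simp
  moreover have "norm (x s - x t) \<le> \<Theta> q1 q2 j \<bar>s - t\<bar>" if s: "s \<in> {q1..q2}" and t: "t \<in> {q1..q2}" for s t
    by (rule tendsto_upperbound[OF tendsto_norm[OF tendsto_diff[OF pt[OF s] pt[OF t]]]])
      (use z s t in \<open>auto simp: moduli_set_def elim!: eventually_mono\<close>)
  ultimately show ?thesis by (auto simp: moduli_set_def)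
qed

section \<open>Continuous dependence for the nonlinear equation\<close>

text \<open>
  For each \<open>n\<close> let \<open>z\<^sub>n\<close> solve the equation of \<open>f\<^sub>n\<close> truncated at radius \<open>j\<close>, on all of \<open>[q\<^sub>1, q\<^sub>2]\<close>.
  Its projection \<open>w\<^sub>n\<close> lies in \<open>\<K>\<^sup>I\<^sub>j\<close>, so \<open>f\<^sub>n - f\<close> is small in \<open>L\<^sup>1\<close> along \<open>w\<^sub>n\<close>. Since
  \<open>z\<^sub>n' - x' = (f\<^sub>n - f)(t, w\<^sub>n) + (f(t, w\<^sub>n) - f(t, x))\<close> and the last difference is at most
  \<open>l |w\<^sub>n - x| \<le> l |z\<^sub>n - x|\<close>, Gronwall's inequality gives \<open>z\<^sub>n \<rightarrow> x\<close> uniformly. The ball has room of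
  size 1 around \<open>x\<close>, so eventually \<open>z\<^sub>n\<close> stays inside and solves the equation without truncation.
\<close>

lemma solutions_converge_on:
  fixes fs :: "nat \<Rightarrow> real \<Rightarrow> 'a::euclidean_space \<Rightarrow> 'a"
  assumes p: "1 \<le> p" and E: "E \<subseteq> LC p" "L1loc_equicontinuous_m_bounds E"
    and fs: "\<And>n. fs n \<in> E" and f: "f \<in> LC p"
    and lim: "limitin (T_Theta (moduli_of E) p (LC p)) fs f sequentially" and x0s: "x0s \<longlonglongrightarrow> x0"
    and q: "q1 \<in> \<rat>" "q2 \<in> \<rat>" "q1 \<le> 0" "0 \<le> q2"
    and x: "solves_on f x0 q1 q2 x" and j: "\<And>t. t \<in> {q1..q2} \<Longrightarrow> norm (x t) + 1 \<le> real j"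
  obtains z where "uniform_limit {q1..q2} z x sequentially"
    "\<forall>\<^sub>F n in sequentially. solves_on (fs n) (x0s n) q1 q2 (z n)"
proof -
  have "\<exists>z. solves_on (\<lambda>t v. fs n t (truncate (real j) v)) (x0s n) q1 q2 z" for n
    using truncated_solution_exists[OF p, of "fs n" q1 q2 "real j" "x0s n"] fs E q by (metis of_nat_0_le_iff subsetD)
  then obtain z where z: "\<And>n. solves_on (\<lambda>t v. fs n t (truncate (real j) v)) (x0s n) q1 q2 (z n)" by metis
  have zc: "continuous_on {q1..q2} (z n)" for n using z by (simp add: solves_on_def)
  have xc: "continuous_on {q1..q2} x" using x by (simp add: solves_on_def)
  define w where "w n t = truncate (real j) (z n t)" for n t
  have wc: "continuous_on {q1..q2} (w n)" for n
    unfolding w_def by (rule continuous_on_truncate[OF _ zc]) simp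
  have wj: "w n t \<in> cball 0 (real j)" for n t unfolding w_def by (rule truncate_in_cball) simp
  have w: "w n \<in> moduli_set (moduli_of E) q1 q2 j" for n
    unfolding moduli_set_def
  proof (intro CollectI conjI ballI wc)
    fix s t assume st: "s \<in> {q1..q2}" "t \<in> {q1..q2}"
    have "norm (w n s - w n t) \<le> norm (z n s - z n t)"
      unfolding w_def by (rule norm_truncate_diff_le) simp
    also have "\<dots> \<le> moduli_of E q1 q2 j \<bar>s - t\<bar>"
      by (rule norm_solution_diff_le_moduli_of[OF E p fs q(3,4) z _ _ st]) (use wc wj in \<open>simp_all add: w_def\<close>)
    finally show "norm (w n s - w n t) \<le> moduli_of E q1 q2 j \<bar>s - t\<bar>" .
  qed (use wj in auto)
  define d where "d n = (LINT t:{q1..q2}|lborel. norm (fs n t (w n t) - f t (w n t)))" for n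
  have d: "d \<longlonglongrightarrow> 0"
    unfolding d_def
    by (rule T_Theta_L1_tendsto_along_curves[OF p _ lim _ w q(1,2)])
      (use fs E q in \<open>auto simp: LC_def\<close>)
  define c where "c n = norm (x0s n - x0) + d n" for n
  have "c \<longlonglongrightarrow> norm (x0 - x0) + 0" unfolding c_def by (intro tendsto_intros x0s d)
  then have c: "c \<longlonglongrightarrow> 0" by simp
  obtain l where l: "Lp_majorant p l"
    "AE t in lborel. \<forall>x\<in>cball 0 (real j). \<forall>y\<in>cball 0 (real j). norm (f t x - f t y) \<le> l t * norm (x - y)"
    using LC_lipschitz_majorant[OF p f, of "real j"] .
  note li = Lp_majorantD(2)[OF l(1)] and l0 = Lp_majorantD(1)[OF l(1)]
  obtain C where C: "0 < C" "\<forall>c u. continuous_on {q1..q2} u \<and>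
      (\<forall>s\<in>{q1..q2}. 0 \<le> u s \<and> u s \<le> c + (LINT r:closed_segment 0 s|lborel. l r * u r)) \<longrightarrow>
      (\<forall>t\<in>{q1..q2}. u t \<le> C * c)"
    using gronwall[OF li l0 q(3,4)] by blast
  have close: "norm (z n t - x t) \<le> C * c n" if t: "t \<in> {q1..q2}" for n t
  proof (rule C(2)[rule_format, OF _ t], intro conjI ballI norm_ge_zero)
    show uc: "continuous_on {q1..q2} (\<lambda>t. norm (z n t - x t))" by (intro continuous_intros zc xc)
    fix s assume s: "s \<in> {q1..q2}"
    have S: "closed_segment 0 s \<subseteq> {q1..q2}" using s q by (auto simp: closed_segment_eq_real_ivl)
    note seg = set_integrable_segment[OF _ q(3,4) s]
    have fn: "C1 (fs n)" "C2 p (fs n)" and f': "C1 f" "C2 p f" using fs E f by (auto simp: LC_def)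
    have i1: "set_integrable lborel {q1..q2} (\<lambda>r. norm (fs n r (w n r) - f r (w n r)))"
      by (rule set_integrable_norm[OF set_integral_diff(1)[OF curve_integrable[OF p fn wc] curve_integrable[OF p f' wc]]])
    have i2: "set_integrable lborel {q1..q2} (\<lambda>r. l r * norm (z n r - x r))"
      by (rule set_integrable_mult_continuous[OF li uc])
    have i3: "set_integrable lborel {q1..q2} (\<lambda>r. norm (fs n r (w n r) - f r (x r)))"
      by (rule set_integrable_norm[OF set_integral_diff(1)[OF curve_integrable[OF p fn wc] curve_integrable[OF p f' xc]]])
    have "norm (z n s - x s) \<le> norm (x0s n - x0) +
        (LINT r:closed_segment 0 s|lborel. norm (fs n r (w n r) - f r (x r)))"
      unfolding w_def by (rule norm_solution_diff_le[OF z x q(3,4) s])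
    also have "(LINT r:closed_segment 0 s|lborel. norm (fs n r (w n r) - f r (x r))) \<le>
      (LINT r:closed_segment 0 s|lborel. norm (fs n r (w n r) - f r (w n r)) + l r * norm (z n r - x r))"
    proof (rule set_integral_mono_AE[OF seg[OF i3] set_integral_add(1)[OF seg[OF i1] seg[OF i2]]])
      show "AE r\<in>closed_segment 0 s in lborel. norm (fs n r (w n r) - f r (x r)) \<le>
          norm (fs n r (w n r) - f r (w n r)) + l r * norm (z n r - x r)"
        using l(2)
      proof (eventually_elim, intro impI)
        fix r assume lip: "\<forall>x\<in>cball 0 (real j). \<forall>y\<in>cball 0 (real j). norm (f r x - f r y) \<le> l r * norm (x - y)"
          and r: "r \<in> closed_segment 0 s"
        have xr: "x r \<in> cball 0 (real j)" using j[of r] r S by auto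
        have "norm (f r (w n r) - f r (x r)) \<le> l r * norm (w n r - x r)"
          using lip wj xr by blast
        also have "norm (w n r - x r) \<le> norm (z n r - x r)"
          using norm_truncate_diff_le[of "real j" "z n r" "x r"] xr by (simp add: w_def closest_point_self)
        finally have "norm (f r (w n r) - f r (x r)) \<le> l r * norm (z n r - x r)"
          using l0[of r] by (simp add: mult_left_mono)
        then show "norm (fs n r (w n r) - f r (x r)) \<le>
          norm (fs n r (w n r) - f r (w n r)) + l r * norm (z n r - x r)"
          using norm_triangle_ineq[of "fs n r (w n r) - f r (w n r)" "f r (w n r) - f r (x r)"] by simp
      qed
    qed
    also have "\<dots> = (LINT r:closed_segment 0 s|lborel. norm (fs n r (w n r) - f r (w n r))) +
        (LINT r:closed_segment 0 s|lborel. l r * norm (z n r - x r))"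
      by (rule set_integral_add(2)[OF seg[OF i1] seg[OF i2]])
    also have "(LINT r:closed_segment 0 s|lborel. norm (fs n r (w n r) - f r (w n r))) \<le> d n"
      unfolding d_def by (rule set_integral_mono_subset[OF i1 S]) (auto simp: closed_segment_eq_real_ivl)
    finally show "norm (z n s - x s) \<le> c n + (LINT r:closed_segment 0 s|lborel. l r * norm (z n r - x r))"
      by (simp add: c_def)
  qed
  have Cc: "(\<lambda>n. C * c n) \<longlonglongrightarrow> 0" using tendsto_mult_right_zero[OF c] .
  show thesis
  proof (rule that)
    show "uniform_limit {q1..q2} z x sequentially"
    proof (rule uniform_limitI)
      fix e :: real assume "0 < e"
      then have "\<forall>\<^sub>F n in sequentially. C * c n < e" using Cc by (intro order_tendstoD) auto
      then show "\<forall>\<^sub>F n in sequentially. \<forall>t\<in>{q1..q2}. dist (z n t) (x t) < e"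
        by eventually_elim (unfold dist_norm, blast intro: le_less_trans close)
    qed
    have "\<forall>\<^sub>F n in sequentially. C * c n < 1" using Cc by (intro order_tendstoD) auto
    then show "\<forall>\<^sub>F n in sequentially. solves_on (fs n) (x0s n) q1 q2 (z n)"
    proof eventually_elim
      case (elim n)
      show ?case
      proof (rule solves_on_cong[OF z[of n]])
        fix t assume t: "t \<in> {q1..q2}"
        have "norm (z n t) \<le> real j"
          using close[OF t, of n] elim j[OF t] norm_triangle_sub[of "z n t" "x t"] by linarith
        then show "fs n t (z n t) = fs n t (truncate (real j) (z n t))"
          by (simp add: closest_point_self)
      qed (use q in auto)
    qed
  qed
qed

text \<open>
  The solutions on \<open>[q\<^sub>1, q\<^sub>2]\<close> found above are the maximal ones, restricted. In particular their
  existence shows that the maximal intervals eventually contain \<open>[T\<^sub>1, T\<^sub>2]\<close>.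
\<close>

lemma sol_converge_on:
  fixes fs :: "nat \<Rightarrow> real \<Rightarrow> 'a::euclidean_space \<Rightarrow> 'a"
  assumes p: "1 \<le> p" and E: "E \<subseteq> LC p" "L1loc_equicontinuous_m_bounds E"
    and fs: "\<And>n. fs n \<in> E" and f: "f \<in> LC p"
    and lim: "limitin (T_Theta (moduli_of E) p (LC p)) fs f sequentially" and x0s: "x0s \<longlonglongrightarrow> x0"
    and T: "{T1..T2} \<subseteq> sol_interval f x0"
  shows "\<forall>\<^sub>F n in sequentially. {T1..T2} \<subseteq> sol_interval (fs n) (x0s n)"
    and "uniform_limit {T1..T2} (\<lambda>n. sol (fs n) (x0s n)) (sol f x0) sequentially"
proof -
  have "(\<forall>\<^sub>F n in sequentially. {T1..T2} \<subseteq> sol_interval (fs n) (x0s n)) \<and>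
    uniform_limit {T1..T2} (\<lambda>n. sol (fs n) (x0s n)) (sol f x0) sequentially"
  proof (cases "T1 \<le> T2")
    case False
    then show ?thesis by (auto simp: uniform_limit_iff)
  next
    case True
    note x = LC_sol[OF p f, of x0]
    then have I: "open (sol_interval f x0)" "is_interval (sol_interval f x0)" "0 \<in> sol_interval f x0"
      by (auto simp: caratheodory_solution_def)
    obtain q1 q2 where q: "q1 \<in> \<rat>" "q2 \<in> \<rat>" "q1 < 0" "0 < q2" "q1 < T1" "T2 < q2" "{q1..q2} \<subseteq> sol_interval f x0"
      using rational_enclosure[OF I T True] .
    have xs: "solves_on f x0 q1 q2 (sol f x0)"
      by (rule caratheodory_imp_solves_on[OF x]) (use q in auto)
    then have "continuous_on {q1..q2} (sol f x0)" by (simp add: solves_on_def)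
    then obtain R where R: "\<And>t. t \<in> {q1..q2} \<Longrightarrow> norm (sol f x0 t) \<le> R" using bounded_on_Icc by blast
    obtain j :: nat where j: "R + 1 \<le> real j" using real_arch_simple by blast
    obtain z where z: "uniform_limit {q1..q2} z (sol f x0) sequentially"
      "\<forall>\<^sub>F n in sequentially. solves_on (fs n) (x0s n) q1 q2 (z n)"
    proof (rule solutions_converge_on[OF p E fs f lim x0s q(1,2) _ _ xs, of j])
      show "norm (sol f x0 t) + 1 \<le> real j" if "t \<in> {q1..q2}" for t using R[OF that] j by simp
    qed (use q in auto)
    have good: "\<forall>\<^sub>F n in sequentially. {q1<..<q2} \<subseteq> sol_interval (fs n) (x0s n) \<and>
        (\<forall>t\<in>{q1<..<q2}. sol (fs n) (x0s n) t = z n t)"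
      using z(2)
    proof eventually_elim
      case (elim n)
      have c: "caratheodory_solution (fs n) (x0s n) {q1<..<q2} (z n)"
        by (rule solves_on_imp_caratheodory[OF elim q(3,4)])
      have "L1_lipschitz (fs n) UNIV" using LC_imp_L1_lipschitz[OF p] fs E by blast
      then show ?case using sol_interval_greatest(2,3)[OF _ c] by blast
    qed
    have TT: "{T1..T2} \<subseteq> {q1<..<q2}" using q by auto
    have "uniform_limit {T1..T2} z (sol f x0) sequentially"
      by (rule uniform_limit_on_subset[OF z(1)]) (use q in auto)
    then have "uniform_limit {T1..T2} (\<lambda>n. sol (fs n) (x0s n)) (sol f x0) sequentially"
      by (rule uniform_limit_cong[THEN iffD1, rotated 2])
        (use good TT in \<open>auto elim!: eventually_mono\<close>)
    moreover have "\<forall>\<^sub>F n in sequentially. {T1..T2} \<subseteq> sol_interval (fs n) (x0s n)"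
      using good by eventually_elim (use TT in blast)
    ultimately show ?thesis by blast
  qed
  then show "\<forall>\<^sub>F n in sequentially. {T1..T2} \<subseteq> sol_interval (fs n) (x0s n)"
    "uniform_limit {T1..T2} (\<lambda>n. sol (fs n) (x0s n)) (sol f x0) sequentially" by blast+
qed

section \<open>Linear equations with integrable coefficients\<close>

text \<open>
  The norm of a matrix as a vector of vectors is the Frobenius norm.
\<close>

lemma norm_matrix_vector_mult_le:
  fixes A :: "real^'n^'m"
  shows "norm (A *v v) \<le> norm A * norm v"
proof -
  have "norm (A *v v) = L2_set (\<lambda>i. norm (A $ i \<bullet> v)) UNIV"
    by (simp add: norm_vec_def matrix_vector_mul_component)
  also have "\<dots> \<le> L2_set (\<lambda>i. norm (A $ i) * norm v) UNIV"
    by (rule L2_set_mono) (simp_all add: Cauchy_Schwarz_ineq2)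
  also have "\<dots> = norm A * norm v"
    by (simp add: norm_vec_def[of A] L2_set_left_distrib)
  finally show ?thesis .
qed

lemma set_borel_measurable_matrix_vector_mult:
  fixes A :: "real \<Rightarrow> real^'n^'m"
  assumes "set_borel_measurable lborel S A" "set_borel_measurable lborel S v"
  shows "set_borel_measurable lborel S (\<lambda>t. A t *v v t)"
proof -
  have c: "continuous_on UNIV (\<lambda>x :: (real^'n^'m) \<times> (real^'n). fst x *v snd x)"
    unfolding matrix_vector_mult_def by (intro continuous_intros)
  have "(\<lambda>t. (indicator S t *\<^sub>R A t) *v (indicator S t *\<^sub>R v t)) \<in> borel_measurable lborel"
    by (rule borel_measurable_continuous_Pair[OF assms[unfolded set_borel_measurable_def] c])
  also have "(\<lambda>t. (indicator S t *\<^sub>R A t) *v (indicator S t *\<^sub>R v t)) = (\<lambda>t. indicator S t *\<^sub>R (A t *v v t))"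
    by (auto simp: indicator_def)
  finally show ?thesis by (simp add: set_borel_measurable_def)
qed

lemma linear_L1_lipschitz:
  fixes A :: "real \<Rightarrow> real^'n^'n"
  assumes A: "\<And>a b. {a..b} \<subseteq> I \<Longrightarrow> set_integrable lborel {a..b} A"
  shows "L1_lipschitz (\<lambda>t v. A t *v v + b t) I"
  unfolding L1_lipschitz_def
proof (intro allI impI)
  fix a c R :: real assume "{a..c} \<subseteq> I"
  then show "\<exists>l. set_integrable lborel {a..c} l \<and> (\<forall>t. 0 \<le> l t) \<and>
       (AE t in lborel. t \<in> {a..c} \<longrightarrow> (\<forall>x\<in>cball 0 R. \<forall>y\<in>cball 0 R.
          norm (A t *v x + b t - (A t *v y + b t)) \<le> l t * norm (x - y)))"
    by (intro exI[of _ "\<lambda>t. norm (A t)"] conjI set_integrable_norm A)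
      (auto simp: norm_matrix_vector_mult_le matrix_vector_mult_diff_distrib[symmetric])
qed

lemma linear_solution_exists:
  fixes A :: "real \<Rightarrow> real^'n^'n"
  assumes I: "open I" "is_interval I" "0 \<in> I"
    and A: "\<And>a b. {a..b} \<subseteq> I \<Longrightarrow> set_integrable lborel {a..b} A"
    and b: "\<And>a c. {a..c} \<subseteq> I \<Longrightarrow> set_integrable lborel {a..c} b"
  obtains y where "caratheodory_solution (\<lambda>t v. A t *v v + b t) y0 I y"
proof -
  let ?g = "\<lambda>t v. A t *v v + b t"
  have loc: "\<exists>y. caratheodory_solution ?g y0 {q1<..<q2} y" if q: "q1 < 0" "0 < q2" "{q1..q2} \<subseteq> I" for q1 q2
  proof (rule picard[of q1 q2 ?g "\<lambda>t. norm (A t)" "\<lambda>t. norm (b t)" y0])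
    note Ai = A[OF q(3)] and bi = b[OF q(3)]
    show "set_borel_measurable lborel {q1..q2} (\<lambda>t. A t *v x t + b t)" if x: "continuous_on {q1..q2} x" for x
    proof -
      have "set_borel_measurable lborel {q1..q2} x"
        using borel_measurable_continuous_on_indicator[OF _ x] by (simp add: set_borel_measurable_def)
      then have "set_borel_measurable lborel {q1..q2} (\<lambda>t. A t *v x t)"
        using Ai by (intro set_borel_measurable_matrix_vector_mult)
          (auto simp: set_integrable_def set_borel_measurable_def)
      then show ?thesis
        using bi unfolding set_integrable_def set_borel_measurable_def scaleR_add_right
        by (intro borel_measurable_add) auto
    qed
    show "AE t in lborel. t \<in> {q1..q2} \<longrightarrow>
        (\<forall>x y. norm (A t *v x + b t - (A t *v y + b t)) \<le> norm (A t) * norm (x - y))"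
      by (auto simp: norm_matrix_vector_mult_le matrix_vector_mult_diff_distrib[symmetric])
    show "set_integrable lborel {q1..q2} (\<lambda>t. norm (A t))" "set_integrable lborel {q1..q2} (\<lambda>t. norm (b t))"
      by (intro set_integrable_norm Ai bi)+
    show ?thesis if "solves_on ?g y0 q1 q2 y" for y
      using solves_on_imp_caratheodory[OF that q(1,2)] by blast
  qed (use q in auto)
  define \<I> where "\<I> = {{q1<..<q2} | q1 q2. q1 < 0 \<and> 0 < q2 \<and> {q1..q2} \<subseteq> I}"
  have cover: "\<exists>J\<in>\<I>. t \<in> J" if "t \<in> I" for t
  proof -
    have "{t..t} \<subseteq> I" using that by simp
    from rational_enclosure[OF I this order_refl] obtain q1 q2 where q: "q1 \<in> \<rat>" "q2 \<in> \<rat>" "q1 < 0" "0 < q2" "q1 < t" "t < q2" "{q1..q2} \<subseteq> I" .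
    then have "{q1<..<q2} \<in> \<I>" unfolding \<I>_def by blast
    with q show ?thesis by (intro bexI[of _ "{q1<..<q2}"]) simp_all
  qed
  have sub: "J \<subseteq> I" if "J \<in> \<I>" for J
    using that unfolding \<I>_def by (force simp: subset_iff)
  have U: "\<Union>\<I> = I" using cover sub by blast
  obtain y where "caratheodory_solution ?g y0 (\<Union>\<I>) y"
  proof (rule caratheodory_glue[of ?g I \<I> y0, OF linear_L1_lipschitz[OF A]])
    show "\<I> \<noteq> {}" using cover[OF I(3)] by blast
    show "J \<subseteq> I \<and> (\<exists>y. caratheodory_solution ?g y0 J y)" if "J \<in> \<I>" for J
      using that loc sub[OF that] unfolding \<I>_def by blast
  qed
  then show thesis using that U by simp
qed

text \<open>
  Gronwall's inequality has to be used with the fixed kernel \<open>|A|\<close>, as its constant depends on the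
  kernel. The difference \<open>u = y\<^sub>n - y\<close> satisfies \<open>u' = A u + (A\<^sub>n - A) y\<^sub>n + (b\<^sub>n - b)\<close>, where
  \<open>|y\<^sub>n| \<le> Y + sup |u|\<close>, with \<open>Y\<close> a bound of \<open>|y|\<close>. The resulting term \<open>C \<parallel>A\<^sub>n - A\<parallel>\<^sub>1 sup |u|\<close> is
  absorbed by the left-hand side for large \<open>n\<close>.
\<close>

lemma linear_solutions_converge_on:
  fixes A :: "real \<Rightarrow> real^'n^'n" and As :: "nat \<Rightarrow> real \<Rightarrow> real^'n^'n"
  assumes q: "q1 \<le> 0" "0 \<le> q2"
    and A: "set_integrable lborel {q1..q2} A" and As: "\<And>n. set_integrable lborel {q1..q2} (As n)"
    and b: "set_integrable lborel {q1..q2} b" and bs: "\<And>n. set_integrable lborel {q1..q2} (bs n)"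
    and limA: "(\<lambda>n. LINT t:{q1..q2}|lborel. norm (As n t - A t)) \<longlonglongrightarrow> 0"
    and limb: "(\<lambda>n. LINT t:{q1..q2}|lborel. norm (bs n t - b t)) \<longlonglongrightarrow> 0"
    and y0s: "y0s \<longlonglongrightarrow> y0"
    and y: "solves_on (\<lambda>t v. A t *v v + b t) y0 q1 q2 y"
    and ys: "\<forall>\<^sub>F n in sequentially. solves_on (\<lambda>t v. As n t *v v + bs n t) (y0s n) q1 q2 (ys n)"
  shows "uniform_limit {q1..q2} ys y sequentially"
proof -
  define \<alpha> where "\<alpha> n = (LINT t:{q1..q2}|lborel. norm (As n t - A t))" for n
  define \<beta> where "\<beta> n = (LINT t:{q1..q2}|lborel. norm (bs n t - b t))" for n
  have yc: "continuous_on {q1..q2} y" using y by (simp add: solves_on_def)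
  then obtain Y where Y: "\<And>t. t \<in> {q1..q2} \<Longrightarrow> norm (y t) \<le> Y" using bounded_on_Icc by blast
  obtain C where C: "0 < C" "\<forall>c u. continuous_on {q1..q2} u \<and>
      (\<forall>s\<in>{q1..q2}. 0 \<le> u s \<and> u s \<le> c + (LINT r:closed_segment 0 s|lborel. norm (A r) * u r)) \<longrightarrow>
      (\<forall>t\<in>{q1..q2}. u t \<le> C * c)"
    using gronwall[OF set_integrable_norm[OF A] norm_ge_zero q] by blast
  define c where "c n = norm (y0s n - y0) + \<alpha> n * Y + \<beta> n" for n
  have "c \<longlonglongrightarrow> norm (y0 - y0) + 0 * Y + 0"
    unfolding c_def \<alpha>_def \<beta>_def by (intro tendsto_intros y0s limA limb)
  then have c: "c \<longlonglongrightarrow> 0" by simp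
  have close: "\<forall>t\<in>{q1..q2}. norm (ys n t - y t) \<le> 2 * C * c n"
    if sol: "solves_on (\<lambda>t v. As n t *v v + bs n t) (y0s n) q1 q2 (ys n)" and small: "C * \<alpha> n \<le> 1 / 2" for n
  proof -
    let ?u = "\<lambda>t. norm (ys n t - y t)"
    have ysc: "continuous_on {q1..q2} (ys n)" using sol by (simp add: solves_on_def)
    have uc: "continuous_on {q1..q2} ?u" by (intro continuous_intros ysc yc)
    obtain t0 where t0: "t0 \<in> {q1..q2}" "\<And>t. t \<in> {q1..q2} \<Longrightarrow> ?u t \<le> ?u t0"
      using continuous_attains_sup[OF compact_Icc _ uc] q by fastforce
    define S where "S = ?u t0"
    have S: "\<And>t. t \<in> {q1..q2} \<Longrightarrow> ?u t \<le> S" using t0(2) by (simp add: S_def)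
    have "?u t0 \<le> C * (c n + \<alpha> n * S)"
    proof (rule C(2)[rule_format, OF _ t0(1)], intro conjI ballI norm_ge_zero uc)
      fix s assume s: "s \<in> {q1..q2}"
      let ?S = "closed_segment 0 s"
      have sub: "?S \<subseteq> {q1..q2}" using s q by (auto simp: closed_segment_eq_real_ivl)
      have Smeas: "?S \<in> sets lborel" by (simp add: closed_segment_eq_real_ivl)
      note seg = set_integrable_segment[OF _ q s]
      let ?d = "\<lambda>r. As n r *v ys n r + bs n r - (A r *v y r + b r)"
      have i1: "set_integrable lborel {q1..q2} (\<lambda>r. norm (A r) * ?u r)"
        by (rule set_integrable_mult_continuous[OF set_integrable_norm[OF A] uc])
      have i2: "set_integrable lborel {q1..q2} (\<lambda>r. norm (As n r - A r))"
        by (rule set_integrable_norm[OF set_integral_diff(1)[OF As A]])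
      have i3: "set_integrable lborel {q1..q2} (\<lambda>r. norm (bs n r - b r))"
        by (rule set_integrable_norm[OF set_integral_diff(1)[OF bs b]])
      have i4: "set_integrable lborel {q1..q2} (\<lambda>r. norm (?d r))"
        using sol y unfolding solves_on_def by (intro set_integrable_norm set_integral_diff(1)) auto
      have i2': "set_integrable lborel {q1..q2} (\<lambda>r. norm (As n r - A r) * (Y + S))" using i2 by simp
      have "?u s \<le> norm (y0s n - y0) + (LINT r:?S|lborel. norm (?d r))"
        by (rule norm_solution_diff_le[OF sol y q s])
      also have "(LINT r:?S|lborel. norm (?d r)) \<le>
        (LINT r:?S|lborel. norm (A r) * ?u r + (norm (As n r - A r) * (Y + S) + norm (bs n r - b r)))"
      proof (rule set_integral_mono[OF seg[OF i4]])
        show "set_integrable lborel ?S (\<lambda>r. norm (A r) * ?u r + (norm (As n r - A r) * (Y + S) + norm (bs n r - b r)))"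
          by (intro set_integral_add(1) seg i1 i2' i3)
        fix r assume "r \<in> ?S"
        then have r: "r \<in> {q1..q2}" using sub by auto
        have d_eq: "?d r = A r *v (ys n r - y r) + ((As n r - A r) *v ys n r + (bs n r - b r))"
          by (simp add: matrix_vector_mult_diff_distrib matrix_vector_mult_diff_rdistrib)
        have "norm (?d r) \<le> norm (A r *v (ys n r - y r)) +
            (norm ((As n r - A r) *v ys n r) + norm (bs n r - b r))"
          unfolding d_eq by (rule norm_triangle_le, rule add_left_mono, rule norm_triangle_ineq)
        moreover have "norm ((As n r - A r) *v ys n r) \<le> norm (As n r - A r) * (Y + S)"
        proof (rule order_trans[OF norm_matrix_vector_mult_le], rule mult_left_mono)
          show "norm (ys n r) \<le> Y + S"
            using norm_triangle_sub[of "ys n r" "y r"] Y[OF r] S[OF r] by linarith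
        qed simp
        ultimately show "norm (?d r) \<le> norm (A r) * ?u r + (norm (As n r - A r) * (Y + S) + norm (bs n r - b r))"
          using norm_matrix_vector_mult_le[of "A r" "ys n r - y r"] by linarith
      qed
      also have "\<dots> = (LINT r:?S|lborel. norm (A r) * ?u r) +
          ((LINT r:?S|lborel. norm (As n r - A r)) * (Y + S) + (LINT r:?S|lborel. norm (bs n r - b r)))"
        by (simp add: set_integral_add(2)[OF seg[OF i1] set_integral_add(1)[OF seg[OF i2'] seg[OF i3]]]
            set_integral_add(2)[OF seg[OF i2'] seg[OF i3]])
      also have "\<dots> \<le> (LINT r:?S|lborel. norm (A r) * ?u r) + (\<alpha> n * (Y + S) + \<beta> n)"
      proof (intro add_mono order_refl mult_right_mono)
        show "(LINT r:?S|lborel. norm (As n r - A r)) \<le> \<alpha> n"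
          unfolding \<alpha>_def by (rule set_integral_mono_subset[OF i2 sub Smeas]) simp
        show "(LINT r:?S|lborel. norm (bs n r - b r)) \<le> \<beta> n"
          unfolding \<beta>_def by (rule set_integral_mono_subset[OF i3 sub Smeas]) simp
        have "0 \<le> Y" using Y[OF t0(1)] norm_ge_zero order_trans by blast
        then show "0 \<le> Y + S" by (simp add: S_def)
      qed
      finally show "?u s \<le> c n + \<alpha> n * S + (LINT r:?S|lborel. norm (A r) * ?u r)"
        by (simp add: c_def algebra_simps)
    qed
    then have "S \<le> C * c n + (C * \<alpha> n) * S" by (simp add: S_def algebra_simps)
    also have "\<dots> \<le> C * c n + 1 / 2 * S"
      using small by (intro add_left_mono mult_right_mono) (simp_all add: S_def)
    finally have "S \<le> 2 * C * c n" by simp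
    then show ?thesis using S order_trans by blast
  qed
  have "(\<lambda>n. C * \<alpha> n) \<longlonglongrightarrow> 0" using tendsto_mult_right_zero[OF limA] by (simp add: \<alpha>_def)
  then have small: "\<forall>\<^sub>F n in sequentially. C * \<alpha> n < 1 / 2" by (rule order_tendstoD) simp
  have Cc: "(\<lambda>n. 2 * C * c n) \<longlonglongrightarrow> 0" using tendsto_mult_right_zero[OF c] .
  show ?thesis
  proof (rule uniform_limitI)
    fix e :: real assume "0 < e"
    then have "\<forall>\<^sub>F n in sequentially. 2 * C * c n < e" using Cc by (intro order_tendstoD) auto
    then show "\<forall>\<^sub>F n in sequentially. \<forall>t\<in>{q1..q2}. dist (ys n t) (y t) < e"
      using ys small
    proof eventually_elim
      case (elim n)
      then show ?case using close[of n] unfolding dist_norm by (meson less_imp_le le_less_trans)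
    qed
  qed
qed

text \<open>
  \<open>g\<^sub>n(t, w\<^sub>n) - g(t, x)\<close> is the sum of \<open>(g\<^sub>n - g)(t, w\<^sub>n)\<close>, which the topology controls, and of
  \<open>g(t, w\<^sub>n) - g(t, x)\<close>, which the defining continuity property of \<open>\<Theta>C\<^sub>p\<close> controls as all curves
  have the same modulus of continuity.
\<close>

lemma ThetaC_L1_tendsto_along_curves:
  fixes gs :: "nat \<Rightarrow> real \<Rightarrow> 'a::euclidean_space \<Rightarrow> 'b::euclidean_space"
  assumes p: "1 \<le> p" and lim: "limitin (T_Theta \<Theta> p (ThetaC \<Theta> p)) gs g sequentially"
    and gs: "\<And>n. gs n \<in> ThetaC \<Theta> p" and g: "g \<in> ThetaC \<Theta> p"
    and w: "\<And>n. w n \<in> moduli_set \<Theta> q1 q2 j" and x: "x \<in> moduli_set \<Theta> q1 q2 j"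
    and wx: "uniform_limit {q1..q2} w x sequentially"
    and q: "q1 \<in> \<rat>" "q2 \<in> \<rat>" "q1 \<le> q2"
  shows "(\<lambda>n. LINT t:{q1..q2}|lborel. norm (gs n t (w n t) - g t (x t))) \<longlonglongrightarrow> 0"
proof -
  have C: "\<And>f. f \<in> ThetaC \<Theta> p \<Longrightarrow> C1 f \<and> C2 p f" by (simp add: ThetaC_def)
  have g': "C1 g" "C2 p g" and gs': "\<And>n. C1 (gs n)" "\<And>n. C2 p (gs n)" using C g gs by auto
  have w': "continuous_on {q1..q2} (w n)" "w n ` {q1..q2} \<subseteq> cball 0 (real j)" for n
    using w by (auto simp: moduli_set_def)
  have x': "continuous_on {q1..q2} x" "x ` {q1..q2} \<subseteq> cball 0 (real j)"
    using x by (auto simp: moduli_set_def)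
  note ign = curve_integrable[OF p gs' w'(1)] and igw = curve_integrable[OF p g' w'(1)]
    and igx = curve_integrable[OF p g' x'(1)]
  have 1: "(\<lambda>n. LINT t:{q1..q2}|lborel. norm (gs n t (w n t) - g t (w n t))) \<longlonglongrightarrow> 0"
    by (rule T_Theta_L1_tendsto_along_curves[OF p C lim gs w q])
  have 2: "(\<lambda>n. LINT t:{q1..q2}|lborel. norm (g t (w n t) - g t (x t))) \<longlonglongrightarrow> 0"
  proof (rule Lp_null_imp_L1_null[OF p q(3) norm_ge_zero])
    show "set_integrable lborel {q1..q2} (\<lambda>t. norm (g t (w n t) - g t (x t)))" for n
      by (rule set_integrable_norm[OF set_integral_diff(1)[OF igw igx]])
    show "set_integrable lborel {q1..q2} (\<lambda>t. norm (g t (w n t) - g t (x t)) powr p)" for n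
      using curve_diff_powr[OF p g' g', of q1 q2 "real j"] w'[of n] x' by blast
    show "(\<lambda>n. LINT t:{q1..q2}|lborel. norm (g t (w n t) - g t (x t)) powr p) \<longlonglongrightarrow> 0"
      using g q w x wx unfolding ThetaC_def by blast
  qed
  show ?thesis
  proof (rule tendsto_sandwich[OF _ _ tendsto_const tendsto_add_zero[OF 1 2]])
    show "\<forall>\<^sub>F n in sequentially. 0 \<le> (LINT t:{q1..q2}|lborel. norm (gs n t (w n t) - g t (x t)))"
      unfolding set_lebesgue_integral_def by (intro always_eventually allI integral_nonneg_AE) auto
    show "\<forall>\<^sub>F n in sequentially. (LINT t:{q1..q2}|lborel. norm (gs n t (w n t) - g t (x t))) \<le>
        (LINT t:{q1..q2}|lborel. norm (gs n t (w n t) - g t (w n t))) +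
        (LINT t:{q1..q2}|lborel. norm (g t (w n t) - g t (x t)))"
    proof (intro always_eventually allI)
      fix n
      have i: "set_integrable lborel {q1..q2} (\<lambda>t. norm (gs n t (w n t) - g t (w n t)))"
        "set_integrable lborel {q1..q2} (\<lambda>t. norm (g t (w n t) - g t (x t)))"
        "set_integrable lborel {q1..q2} (\<lambda>t. norm (gs n t (w n t) - g t (x t)))"
        by (intro set_integrable_norm set_integral_diff(1) ign igw igx)+
      have "(LINT t:{q1..q2}|lborel. norm (gs n t (w n t) - g t (x t))) \<le>
        (LINT t:{q1..q2}|lborel. norm (gs n t (w n t) - g t (w n t)) + norm (g t (w n t) - g t (x t)))"
      proof (rule set_integral_mono[OF i(3) set_integral_add(1)[OF i(1,2)]])
        show "norm (gs n t (w n t) - g t (x t)) \<le>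
            norm (gs n t (w n t) - g t (w n t)) + norm (g t (w n t) - g t (x t))" for t
          using norm_triangle_ineq[of "gs n t (w n t) - g t (w n t)" "g t (w n t) - g t (x t)"] by simp
      qed
      then show "(LINT t:{q1..q2}|lborel. norm (gs n t (w n t) - g t (x t))) \<le>
        (LINT t:{q1..q2}|lborel. norm (gs n t (w n t) - g t (w n t))) +
        (LINT t:{q1..q2}|lborel. norm (g t (w n t) - g t (x t)))"
        by (simp add: set_integral_add(2)[OF i(1,2)])
    qed
  qed
qed

lemma lin_sol_solution:
  assumes p: "1 \<le> p" and f: "f \<in> LC p" and F: "C1 F" "C2 p F" and h: "C1 h" "C2 p h"
  shows "caratheodory_solution (\<lambda>t v. F t (sol f x0 t) *v v + h t (sol f x0 t)) y0
    (sol_interval f x0) (lin_sol f F h x0 y0)"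
proof -
  note x = LC_sol[OF p f, of x0]
  then have I: "open (sol_interval f x0)" "is_interval (sol_interval f x0)" "0 \<in> sol_interval f x0"
    and xc: "continuous_on (sol_interval f x0) (sol f x0)"
    by (auto simp: caratheodory_solution_def)
  obtain y where "caratheodory_solution (\<lambda>t v. F t (sol f x0 t) *v v + h t (sol f x0 t)) y0 (sol_interval f x0) y"
  proof (rule linear_solution_exists[OF I])
    fix a b assume "{a..b} \<subseteq> sol_interval f x0"
    note c = continuous_on_subset[OF xc this]
    show "set_integrable lborel {a..b} (\<lambda>t. F t (sol f x0 t))" by (rule curve_integrable[OF p F c])
    show "set_integrable lborel {a..b} (\<lambda>t. h t (sol f x0 t))" by (rule curve_integrable[OF p h c])
  qed
  then show ?thesis unfolding lin_sol_def by (rule someI[of "caratheodory_solution _ _ _"])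
qed

text \<open>
  The coefficients are evaluated along the solutions of the nonlinear equations, which eventually have
  the modulus of continuity \<open>\<theta>\<^sup>I\<^sub>j\<close>, as does their uniform limit. So the coefficients converge in
  \<open>L\<^sup>1\<close>.
\<close>

lemma lin_sol_converge_on:
  fixes fs :: "nat \<Rightarrow> real \<Rightarrow> real^'n \<Rightarrow> real^'n" and Fs :: "nat \<Rightarrow> real \<Rightarrow> real^'n \<Rightarrow> real^'n^'n"
  assumes p: "1 \<le> p" and E: "E \<subseteq> LC p" "L1loc_equicontinuous_m_bounds E" and \<Theta>: "\<Theta> = moduli_of E"
    and fs: "\<And>n. fs n \<in> E" and f: "f \<in> LC p"
    and limf: "limitin (T_Theta \<Theta> p (LC p)) fs f sequentially" and x0s: "x0s \<longlonglongrightarrow> x0"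
    and Fs: "\<And>n. Fs n \<in> ThetaC \<Theta> p" and F: "F \<in> ThetaC \<Theta> p"
    and limF: "limitin (T_Theta \<Theta> p (ThetaC \<Theta> p)) Fs F sequentially"
    and hs: "\<And>n. hs n \<in> ThetaC \<Theta> p" and h: "h \<in> ThetaC \<Theta> p"
    and limh: "limitin (T_Theta \<Theta> p (ThetaC \<Theta> p)) hs h sequentially"
    and y0s: "y0s \<longlonglongrightarrow> y0" and T: "{T1..T2} \<subseteq> sol_interval f x0"
  shows "uniform_limit {T1..T2} (\<lambda>n. lin_sol (fs n) (Fs n) (hs n) (x0s n) (y0s n))
    (lin_sol f F h x0 y0) sequentially"
proof (cases "T1 \<le> T2")
  case False
  then show ?thesis by (simp add: uniform_limit_iff)
next
  case True
  let ?x = "sol f x0" and ?X = "\<lambda>n. sol (fs n) (x0s n)"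
  note limf' = limf[unfolded \<Theta>]
  note x = LC_sol[OF p f, of x0]
  then have I: "open (sol_interval f x0)" "is_interval (sol_interval f x0)" "0 \<in> sol_interval f x0"
    by (auto simp: caratheodory_solution_def)
  obtain q1 q2 where q: "q1 \<in> \<rat>" "q2 \<in> \<rat>" "q1 < 0" "0 < q2" "q1 < T1" "T2 < q2" "{q1..q2} \<subseteq> sol_interval f x0"
    using rational_enclosure[OF I T True] .
  have q': "q1 \<le> 0" "0 \<le> q2" "q1 \<le> q2" using q by auto
  have xc: "continuous_on {q1..q2} ?x"
    using caratheodory_imp_solves_on[OF x q'(1,2) q(7)] by (simp add: solves_on_def)
  then obtain R where R: "\<And>t. t \<in> {q1..q2} \<Longrightarrow> norm (?x t) \<le> R" using bounded_on_Icc by blast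
  obtain j :: nat where j: "R + 1 \<le> real j" using real_arch_simple by blast
  have defd: "\<forall>\<^sub>F n in sequentially. {q1..q2} \<subseteq> sol_interval (fs n) (x0s n)"
    and unif: "uniform_limit {q1..q2} ?X ?x sequentially"
    using sol_converge_on[OF p E fs f limf' x0s q(7)] .
  have X_mod: "\<forall>\<^sub>F n in sequentially. ?X n \<in> moduli_set \<Theta> q1 q2 j"
    using defd uniform_limitD[OF unif zero_less_one]
  proof eventually_elim
    case (elim n)
    have "fs n \<in> LC p" using fs E by blast
    then have s: "solves_on (fs n) (x0s n) q1 q2 (?X n)"
      using caratheodory_imp_solves_on[OF LC_sol[OF p] q'(1,2) elim(1)] by blast
    show ?case
      unfolding \<Theta>
    proof (rule solution_in_moduli_set[OF E p fs q'(1,2) s])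
      fix t assume t: "t \<in> {q1..q2}"
      have "norm (?X n t - ?x t) < 1" using elim(2) t by (simp add: dist_norm)
      then show "norm (?X n t) \<le> real j"
        using norm_triangle_sub[of "?X n t" "?x t"] R[OF t] j by linarith
    qed
  qed
  have x_mod: "?x \<in> moduli_set \<Theta> q1 q2 j" by (rule moduli_set_limit[OF X_mod unif])
  \<comment> \<open>The finitely many solutions that need not exist on the whole interval are replaced.\<close>
  define w where "w n = (if ?X n \<in> moduli_set \<Theta> q1 q2 j then ?X n else ?x)" for n
  have w: "w n \<in> moduli_set \<Theta> q1 q2 j" for n using x_mod by (simp add: w_def)
  have wX: "\<forall>\<^sub>F n in sequentially. w n = ?X n" using X_mod by eventually_elim (simp add: w_def)
  have w_unif: "uniform_limit {q1..q2} w ?x sequentially"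
    by (rule uniform_limit_cong[THEN iffD1, OF _ _ unif]) (use wX in \<open>auto elim!: eventually_mono\<close>)
  have wc: "continuous_on {q1..q2} (w n)" for n using w[of n] by (simp add: moduli_set_def)
  have C: "C1 F" "C2 p F" "C1 h" "C2 p h" "\<And>n. C1 (Fs n)" "\<And>n. C2 p (Fs n)" "\<And>n. C1 (hs n)" "\<And>n. C2 p (hs n)"
    using F h Fs hs by (auto simp: ThetaC_def)
  have "uniform_limit {q1..q2} (\<lambda>n. lin_sol (fs n) (Fs n) (hs n) (x0s n) (y0s n))
    (lin_sol f F h x0 y0) sequentially"
  proof (rule linear_solutions_converge_on[OF q'(1,2), where A="\<lambda>t. F t (?x t)" and b="\<lambda>t. h t (?x t)"
        and As="\<lambda>n t. Fs n t (w n t)" and bs="\<lambda>n t. hs n t (w n t)"])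
    show "(\<lambda>n. LINT t:{q1..q2}|lborel. norm (Fs n t (w n t) - F t (?x t))) \<longlonglongrightarrow> 0"
      by (rule ThetaC_L1_tendsto_along_curves[OF p limF Fs F w x_mod w_unif q(1,2) q'(3)])
    show "(\<lambda>n. LINT t:{q1..q2}|lborel. norm (hs n t (w n t) - h t (?x t))) \<longlonglongrightarrow> 0"
      by (rule ThetaC_L1_tendsto_along_curves[OF p limh hs h w x_mod w_unif q(1,2) q'(3)])
    show "solves_on (\<lambda>t v. F t (?x t) *v v + h t (?x t)) y0 q1 q2 (lin_sol f F h x0 y0)"
      by (rule caratheodory_imp_solves_on[OF lin_sol_solution[OF p f C(1-4)] q'(1,2) q(7)])
    show "\<forall>\<^sub>F n in sequentially. solves_on (\<lambda>t v. Fs n t (w n t) *v v + hs n t (w n t)) (y0s n) q1 q2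
        (lin_sol (fs n) (Fs n) (hs n) (x0s n) (y0s n))"
      using wX defd
    proof eventually_elim
      case (elim n)
      have "fs n \<in> LC p" using fs E by blast
      then show ?case
        using caratheodory_imp_solves_on[OF lin_sol_solution[OF p _ C(5-8)] q'(1,2) elim(2)] elim(1) by simp
    qed
  qed (rule y0s curve_integrable[OF p] C xc wc)+
  then show ?thesis by (rule uniform_limit_on_subset) (use q in auto)
qed

theorem theorem5p5:
  fixes p :: real
    and E :: "(real \<Rightarrow> real^'n \<Rightarrow> real^'n) set"
    and \<Theta> :: moduli
    and fs :: "nat \<Rightarrow> real \<Rightarrow> real^'n \<Rightarrow> real^'n"
    and f :: "real \<Rightarrow> real^'n \<Rightarrow> real^'n"
    and x0s :: "nat \<Rightarrow> real^'n"
    and x0 :: "real^'n"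
  assumes "1 \<le> p"
    and "E \<subseteq> LC p"
    and "L1loc_equicontinuous_m_bounds E"
    and "\<Theta> = moduli_of E"
    and "\<And>n. fs n \<in> E"
    and "f \<in> LC p"
    and "limitin (T_Theta \<Theta> p (LC p)) fs f sequentially"
    and "x0s \<longlonglongrightarrow> x0"
  shows
    "(\<forall>T1 T2. {T1..T2} \<subseteq> sol_interval f x0 \<longrightarrow>
        (\<forall>\<^sub>F n in sequentially. {T1..T2} \<subseteq> sol_interval (fs n) (x0s n)) \<and>
        uniform_limit {T1..T2} (\<lambda>n. sol (fs n) (x0s n)) (sol f x0) sequentially) \<and>
     (\<forall>(Fs :: nat \<Rightarrow> real \<Rightarrow> real^'n \<Rightarrow> real^'n^'n) F
        (hs :: nat \<Rightarrow> real \<Rightarrow> real^'n \<Rightarrow> real^'n) h (y0s :: nat \<Rightarrow> real^'n) y0.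
        (\<forall>n. Fs n \<in> ThetaC \<Theta> p) \<longrightarrow> F \<in> ThetaC \<Theta> p \<longrightarrow>
        limitin (T_Theta \<Theta> p (ThetaC \<Theta> p)) Fs F sequentially \<longrightarrow>
        (\<forall>n. hs n \<in> ThetaC \<Theta> p) \<longrightarrow> h \<in> ThetaC \<Theta> p \<longrightarrow>
        limitin (T_Theta \<Theta> p (ThetaC \<Theta> p)) hs h sequentially \<longrightarrow>
        y0s \<longlonglongrightarrow> y0 \<longrightarrow>
        (\<forall>T1 T2. {T1..T2} \<subseteq> sol_interval f x0 \<longrightarrow>
           (\<forall>\<^sub>F n in sequentially. {T1..T2} \<subseteq> sol_interval (fs n) (x0s n)) \<and>
           uniform_limit {T1..T2} (\<lambda>n. lin_sol (fs n) (Fs n) (hs n) (x0s n) (y0s n))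
             (lin_sol f F h x0 y0) sequentially))"
proof (intro conjI allI impI)
  fix T1 T2 assume T: "{T1..T2} \<subseteq> sol_interval f x0"
  note conv = sol_converge_on[OF assms(1-3,5,6) assms(7)[unfolded assms(4)] assms(8) T]
  show "\<forall>\<^sub>F n in sequentially. {T1..T2} \<subseteq> sol_interval (fs n) (x0s n)"
    and "\<forall>\<^sub>F n in sequentially. {T1..T2} \<subseteq> sol_interval (fs n) (x0s n)"
    and "uniform_limit {T1..T2} (\<lambda>n. sol (fs n) (x0s n)) (sol f x0) sequentially"
    by (rule conv)+
qed (rule lin_sol_converge_on[OF assms(1-8)]; blast)

end
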